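(* Let $U$ be a consistent c.e. theory and $\mathcal X$ a set of sentences. The following are equivalent: (a) $U$ is strongly doubly $\mathcal X$-generative; (b) $U$ is effectively essentially hereditarily $\mathcal X$-creative.
   Context: $\mathsf W_0,\mathsf W_1,\dots$ is a standard enumeration of c.e. sets; sentences are identified with Gödel numbers. $T_{\mathfrak p}$ is the set of theorems of $T$, $T_{\mathfrak r}=\{\phi\mid T\vdash\neg\phi\}$, and $0_U$ is pure predicate logic in the language of $U$. $U$ is strongly doubly $\mathcal X$-generative iff there is a total computable $\Phi$ such that for all $i,j$ with $\mathsf W_i\cap\mathsf W_j=\emptyset$: $\Phi(i,j)\in 0_{U\mathfrak p}$ iff $\Phi(i,j)\in\mathsf W_j$; $\Phi(i,j)\in U_{\mathfrak r}$ iff $\Phi(i,j)\in\mathsf W_i$; and if $\Phi(i,j)\notin\mathsf W_i\cup\mathsf W_j$ then $\Phi(i,j)\in\mathcal X$. $U$ is effectively essentially hereditarily $\mathcal X$-creative iff there is a partial computable $\Phi$ such that for all $i,j,k$: if $\mathsf W_k$ is a consistent extension of $U$ (same language), $\mathsf W_i$ is a subtheory of $\mathsf W_k$ (same language; every element of $\mathsf W_i$ is a theorem of $\mathsf W_k$), and $(\mathsf W_i)_{\mathfrak p}\cap\mathsf W_j=\emptyset$, then $\Phi(i,j,k)$ converges, $\Phi(i,j,k)\in\mathcal X$, and $\Phi(i,j,k)\notin(\mathsf W_i)_{\mathfrak p}\cup\mathsf W_j$. *)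

theory Defs
  imports Main "HOL-Library.Nat_Bijection"
begin

section \<open>Partial computable functions and c.e. sets\<close>

text \<open>
  Programs for the partial recursive functions in one argument; further arguments and
  the data of a recursion are passed through the pairing function \<^const>\<open>prod_encode\<close>.
\<close>

datatype prog =
    PZero | PSucc | PFst | PSnd
  | PPair prog prog
  | PComp prog prog
  | PRec prog prog
  | PMin prog

text \<open>
  \<open>PRec f g\<close> computes \<open>h\<close> with \<open>h (a, 0) = f a\<close> and \<open>h (a, n + 1) = g (a, (n, h (a, n)))\<close>;
  \<open>PMin f\<close> maps \<open>x\<close> to the least \<open>n\<close> with \<open>f (x, n) = 0\<close>, where \<open>f (x, m)\<close> must
  converge for all \<open>m < n\<close>. \<^const>\<open>None\<close> means divergence.
\<close>

primrec run :: "prog \<Rightarrow> nat \<Rightarrow> nat option" where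
  "run PZero x = Some 0"
| "run PSucc x = Some (Suc x)"
| "run PFst x = Some (fst (prod_decode x))"
| "run PSnd x = Some (snd (prod_decode x))"
| "run (PPair f g) x =
     Option.bind (run f x) (\<lambda>a. Option.bind (run g x) (\<lambda>b. Some (prod_encode (a, b))))"
| "run (PComp f g) x = Option.bind (run g x) (run f)"
| "run (PRec f g) x =
     (let (a, n) = prod_decode x in
      rec_nat (run f a)
        (\<lambda>m r. Option.bind r (\<lambda>v. run g (prod_encode (a, prod_encode (m, v))))) n)"
| "run (PMin f) x =
     (let P = (\<lambda>n. run f (prod_encode (x, n)) = Some 0 \<and>
                   (\<forall>m<n. run f (prod_encode (x, m)) \<noteq> None))
      in if \<exists>n. P n then Some (LEAST n. P n) else None)"

lemma prod_decode_le: "fst (prod_decode q) \<le> q" "snd (prod_decode q) \<le> q"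
  by (metis le_prod_encode_1 le_prod_encode_2 prod.collapse prod_decode_inverse)+

function prog_of :: "nat \<Rightarrow> prog" where
  "prog_of n =
     (if n = 0 then PZero else if n = 1 then PSucc
      else if n = 2 then PFst else if n = 3 then PSnd
      else let q = (n - 4) div 4; r = (n - 4) mod 4;
               a = fst (prod_decode q); b = snd (prod_decode q)
           in if r = 0 then PPair (prog_of a) (prog_of b)
              else if r = 1 then PComp (prog_of a) (prog_of b)
              else if r = 2 then PRec (prog_of a) (prog_of b)
              else PMin (prog_of q))"
  by pat_completeness auto

lemma prog_of_decreasing:
  fixes n :: nat
  assumes "n \<noteq> 0" "n \<noteq> 1" "n \<noteq> 2" "n \<noteq> 3"
  shows "(n - 4) div 4 < n"
    and "fst (prod_decode ((n - 4) div 4)) < n"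
    and "snd (prod_decode ((n - 4) div 4)) < n"
proof -
  show *: "(n - 4) div 4 < n" using assms by linarith
  show "fst (prod_decode ((n - 4) div 4)) < n" "snd (prod_decode ((n - 4) div 4)) < n"
    using * prod_decode_le le_less_trans by blast+
qed

termination prog_of
  by (relation "measure id") (simp_all only: in_measure id_apply wf_measure prog_of_decreasing not_False_eq_True)

declare prog_of.simps [simp del]

definition ce_set :: "nat \<Rightarrow> nat set" where
  "ce_set e = {x. run (prog_of e) x \<noteq> None}"

definition ce :: "nat set \<Rightarrow> bool" where
  "ce A \<longleftrightarrow> (\<exists>e. A = ce_set e)"

definition partial_computable :: "(nat \<Rightarrow> nat option) \<Rightarrow> bool" where
  "partial_computable f \<longleftrightarrow> (\<exists>p. \<forall>x. run p x = f x)"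

definition total_computable :: "(nat \<Rightarrow> nat) \<Rightarrow> bool" where
  "total_computable f \<longleftrightarrow> partial_computable (\<lambda>x. Some (f x))"

definition total_computable2 :: "(nat \<Rightarrow> nat \<Rightarrow> nat) \<Rightarrow> bool" where
  "total_computable2 f \<longleftrightarrow>
     total_computable (\<lambda>x. f (fst (prod_decode x)) (snd (prod_decode x)))"

definition partial_computable3 :: "(nat \<Rightarrow> nat \<Rightarrow> nat \<Rightarrow> nat option) \<Rightarrow> bool" where
  "partial_computable3 f \<longleftrightarrow>
     partial_computable (\<lambda>x. f (fst (prod_decode x))
                               (fst (prod_decode (snd (prod_decode x))))
                               (snd (prod_decode (snd (prod_decode x)))))"

lemma Suc_mult4_div_mod:
  fixes q :: nat
  shows "Suc (4 * q) div 4 = q" "Suc (Suc (4 * q)) div 4 = q"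
    "Suc (Suc (Suc (4 * q))) div 4 = q"
    "Suc (4 * q) mod 4 = 1" "Suc (Suc (4 * q)) mod 4 = 2"
    "Suc (Suc (Suc (4 * q))) mod 4 = 3"
  by presburger+

text \<open>Every program occurs in the enumeration.\<close>

lemma surj_prog_of: "\<exists>n. prog_of n = p"
proof (induction p)
  case PZero show ?case by (rule exI[of _ 0]) (simp add: prog_of.simps)
next
  case PSucc show ?case by (rule exI[of _ 1]) (simp add: prog_of.simps)
next
  case PFst show ?case by (rule exI[of _ 2]) (simp add: prog_of.simps)
next
  case PSnd show ?case by (rule exI[of _ 3]) (simp add: prog_of.simps)
next
  case (PPair f g)
  then obtain a b where "prog_of a = f" "prog_of b = g" by blast
  then show ?case
    by (intro exI[of _ "4 * prod_encode (a, b) + 4"]) (subst prog_of.simps, simp add: Let_def Suc_mult4_div_mod)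
next
  case (PComp f g)
  then obtain a b where "prog_of a = f" "prog_of b = g" by blast
  then show ?case
    by (intro exI[of _ "4 * prod_encode (a, b) + 5"]) (subst prog_of.simps, simp add: Let_def Suc_mult4_div_mod)
next
  case (PRec f g)
  then obtain a b where "prog_of a = f" "prog_of b = g" by blast
  then show ?case
    by (intro exI[of _ "4 * prod_encode (a, b) + 6"]) (subst prog_of.simps, simp add: Let_def Suc_mult4_div_mod)
next
  case (PMin f)
  then obtain a where "prog_of a = f" by blast
  then show ?case
    by (intro exI[of _ "4 * a + 7"]) (subst prog_of.simps, simp add: Let_def Suc_mult4_div_mod)
qed


section \<open>First-order predicate logic with identity\<close>

text \<open>
  A language assigns arities to those numbers that name function symbols (constants being
  the nullary ones), and likewise for relation symbols. Variables are de Bruijn indices.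
\<close>

record lang =
  fun_arity :: "nat \<Rightarrow> nat option"
  rel_arity :: "nat \<Rightarrow> nat option"

definition computable_lang :: "lang \<Rightarrow> bool" where
  "computable_lang L \<longleftrightarrow>
     total_computable (\<lambda>f. case fun_arity L f of None \<Rightarrow> 0 | Some k \<Rightarrow> Suc k) \<and>
     total_computable (\<lambda>r. case rel_arity L r of None \<Rightarrow> 0 | Some k \<Rightarrow> Suc k)"

datatype tm = Var nat | Fn nat "tm list"

datatype fm = Fls | Eq tm tm | Rel nat "tm list" | Imp fm fm | All fm

abbreviation Neg :: "fm \<Rightarrow> fm" where
  "Neg \<phi> \<equiv> Imp \<phi> Fls"

primrec wf_tm :: "lang \<Rightarrow> tm \<Rightarrow> bool" where
  "wf_tm L (Var n) \<longleftrightarrow> True"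
| "wf_tm L (Fn f ts) \<longleftrightarrow> fun_arity L f = Some (length ts) \<and> list_all (wf_tm L) ts"

primrec wf_fm :: "lang \<Rightarrow> fm \<Rightarrow> bool" where
  "wf_fm L Fls \<longleftrightarrow> True"
| "wf_fm L (Eq s t) \<longleftrightarrow> wf_tm L s \<and> wf_tm L t"
| "wf_fm L (Rel r ts) \<longleftrightarrow> rel_arity L r = Some (length ts) \<and> list_all (wf_tm L) ts"
| "wf_fm L (Imp \<phi> \<psi>) \<longleftrightarrow> wf_fm L \<phi> \<and> wf_fm L \<psi>"
| "wf_fm L (All \<phi>) \<longleftrightarrow> wf_fm L \<phi>"

text \<open>\<open>closed_tm k\<close> and \<open>closed_fm k\<close>: all free indices are below \<open>k\<close>.\<close>

primrec closed_tm :: "nat \<Rightarrow> tm \<Rightarrow> bool" where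
  "closed_tm k (Var n) \<longleftrightarrow> n < k"
| "closed_tm k (Fn f ts) \<longleftrightarrow> list_all (closed_tm k) ts"

primrec closed_fm :: "nat \<Rightarrow> fm \<Rightarrow> bool" where
  "closed_fm k Fls \<longleftrightarrow> True"
| "closed_fm k (Eq s t) \<longleftrightarrow> closed_tm k s \<and> closed_tm k t"
| "closed_fm k (Rel r ts) \<longleftrightarrow> list_all (closed_tm k) ts"
| "closed_fm k (Imp \<phi> \<psi>) \<longleftrightarrow> closed_fm k \<phi> \<and> closed_fm k \<psi>"
| "closed_fm k (All \<phi>) \<longleftrightarrow> closed_fm (Suc k) \<phi>"

definition sentences :: "lang \<Rightarrow> fm set" where
  "sentences L = {\<phi>. wf_fm L \<phi> \<and> closed_fm 0 \<phi>}"

text \<open>Renaming that makes index \<open>k\<close> fresh, and capture-avoiding substitution for index \<open>k\<close>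
  (which removes that index).\<close>

primrec lift_tm :: "nat \<Rightarrow> tm \<Rightarrow> tm" where
  "lift_tm k (Var n) = (if n < k then Var n else Var (Suc n))"
| "lift_tm k (Fn f ts) = Fn f (map (lift_tm k) ts)"

primrec lift_fm :: "nat \<Rightarrow> fm \<Rightarrow> fm" where
  "lift_fm k Fls = Fls"
| "lift_fm k (Eq s t) = Eq (lift_tm k s) (lift_tm k t)"
| "lift_fm k (Rel r ts) = Rel r (map (lift_tm k) ts)"
| "lift_fm k (Imp \<phi> \<psi>) = Imp (lift_fm k \<phi>) (lift_fm k \<psi>)"
| "lift_fm k (All \<phi>) = All (lift_fm (Suc k) \<phi>)"

primrec subst_tm :: "nat \<Rightarrow> tm \<Rightarrow> tm \<Rightarrow> tm" where
  "subst_tm k u (Var n) = (if n < k then Var n else if n = k then u else Var (n - 1))"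
| "subst_tm k u (Fn f ts) = Fn f (map (subst_tm k u) ts)"

primrec subst_fm :: "nat \<Rightarrow> tm \<Rightarrow> fm \<Rightarrow> fm" where
  "subst_fm k u Fls = Fls"
| "subst_fm k u (Eq s t) = Eq (subst_tm k u s) (subst_tm k u t)"
| "subst_fm k u (Rel r ts) = Rel r (map (subst_tm k u) ts)"
| "subst_fm k u (Imp \<phi> \<psi>) = Imp (subst_fm k u \<phi>) (subst_fm k u \<psi>)"
| "subst_fm k u (All \<phi>) = All (subst_fm (Suc k) (lift_tm 0 u) \<phi>)"

text \<open>
  Hilbert-style derivability in the language \<open>L\<close>. It is only applied to sets \<open>T\<close> of
  sentences of \<open>L\<close>, so the generalization rule needs no side condition.
\<close>

inductive prv :: "lang \<Rightarrow> fm set \<Rightarrow> fm \<Rightarrow> bool" for L :: lang and T :: "fm set" where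
  Ax: "\<phi> \<in> T \<Longrightarrow> prv L T \<phi>"
| K: "wf_fm L \<phi> \<Longrightarrow> wf_fm L \<psi> \<Longrightarrow> prv L T (Imp \<phi> (Imp \<psi> \<phi>))"
| S: "wf_fm L \<phi> \<Longrightarrow> wf_fm L \<psi> \<Longrightarrow> wf_fm L \<chi> \<Longrightarrow>
      prv L T (Imp (Imp \<phi> (Imp \<psi> \<chi>)) (Imp (Imp \<phi> \<psi>) (Imp \<phi> \<chi>)))"
| DN: "wf_fm L \<phi> \<Longrightarrow> prv L T (Imp (Neg (Neg \<phi>)) \<phi>)"
| AllE: "wf_fm L \<phi> \<Longrightarrow> wf_tm L t \<Longrightarrow> prv L T (Imp (All \<phi>) (subst_fm 0 t \<phi>))"
| AllImp: "wf_fm L \<phi> \<Longrightarrow> wf_fm L \<psi> \<Longrightarrow>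
      prv L T (Imp (All (Imp \<phi> \<psi>)) (Imp (All \<phi>) (All \<psi>)))"
| Vac: "wf_fm L \<phi> \<Longrightarrow> prv L T (Imp \<phi> (All (lift_fm 0 \<phi>)))"
| Refl: "wf_tm L t \<Longrightarrow> prv L T (Eq t t)"
| Leibniz: "wf_tm L s \<Longrightarrow> wf_tm L t \<Longrightarrow> wf_fm L \<phi> \<Longrightarrow>
      prv L T (Imp (Eq s t) (Imp (subst_fm 0 s \<phi>) (subst_fm 0 t \<phi>)))"
| MP: "prv L T (Imp \<phi> \<psi>) \<Longrightarrow> prv L T \<phi> \<Longrightarrow> prv L T \<psi>"
| Gen: "prv L T \<phi> \<Longrightarrow> prv L T (All \<phi>)"

definition is_theory :: "lang \<Rightarrow> fm set \<Rightarrow> bool" where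
  "is_theory L T \<longleftrightarrow> T \<subseteq> sentences L"

definition consistent :: "lang \<Rightarrow> fm set \<Rightarrow> bool" where
  "consistent L T \<longleftrightarrow> \<not> prv L T Fls"

definition provable_set :: "lang \<Rightarrow> fm set \<Rightarrow> fm set" where
  "provable_set L T = {\<phi> \<in> sentences L. prv L T \<phi>}"

definition refutable_set :: "lang \<Rightarrow> fm set \<Rightarrow> fm set" where
  "refutable_set L T = {\<phi> \<in> sentences L. prv L T (Neg \<phi>)}"

text \<open>Extension and subtheory are meant deductively: the axioms of the weaker theory are
  theorems of the stronger one.\<close>

definition subtheory :: "lang \<Rightarrow> fm set \<Rightarrow> fm set \<Rightarrow> bool" where
  "subtheory L S T \<longleftrightarrow> is_theory L S \<and> is_theory L T \<and> S \<subseteq> provable_set L T"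


section \<open>Goedel numbering\<close>

primrec gn_tm :: "tm \<Rightarrow> nat" where
  "gn_tm (Var n) = prod_encode (0, n)"
| "gn_tm (Fn f ts) = prod_encode (1, prod_encode (f, list_encode (map gn_tm ts)))"

primrec gn :: "fm \<Rightarrow> nat" where
  "gn Fls = prod_encode (0, 0)"
| "gn (Eq s t) = prod_encode (1, prod_encode (gn_tm s, gn_tm t))"
| "gn (Rel r ts) = prod_encode (2, prod_encode (r, list_encode (map gn_tm ts)))"
| "gn (Imp \<phi> \<psi>) = prod_encode (3, prod_encode (gn \<phi>, gn \<psi>))"
| "gn (All \<phi>) = prod_encode (4, gn \<phi>)"

lemma gn_tm_inject: "gn_tm s = gn_tm t \<Longrightarrow> s = t"
proof (induction s arbitrary: t)
  case (Var n) then show ?case by (cases t) auto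
next
  case (Fn f ts)
  from Fn.prems obtain us where t: "t = Fn f us" and eq: "map gn_tm ts = map gn_tm us"
    by (cases t) (auto simp: list_encode_eq)
  have "ts = us"
    using eq Fn.IH by (auto intro: map_injective simp: list_eq_iff_nth_eq)
  with t show ?case by simp
qed

lemma inj_gn: "inj gn"
proof (rule injI)
  have inj_tm: "inj gn_tm" by (simp add: injI gn_tm_inject)
  fix \<phi> \<psi> assume "gn \<phi> = gn \<psi>"
  then show "\<phi> = \<psi>"
  proof (induction \<phi> arbitrary: \<psi>)
    case Fls then show ?case by (cases \<psi>) auto
  next
    case (Eq s t) then show ?case by (cases \<psi>) (auto dest: gn_tm_inject)
  next
    case (Rel r ts) then show ?case
      by (cases \<psi>) (auto simp: list_encode_eq dest: map_injective[OF _ inj_tm])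
  next
    case (Imp \<phi>1 \<phi>2) then show ?case by (cases \<psi>) auto
  next
    case (All \<phi>) then show ?case by (cases \<psi>) auto
  qed
qed


section \<open>Generativity and creativity\<close>

text \<open>
  The c.e. sets are sets of arbitrary numbers. Such a set counts as a theory in \<open>L\<close> only
  if all its elements are Goedel numbers of sentences of \<open>L\<close>; \<open>ax e\<close> is the set of
  formulas with Goedel number in the \<open>e\<close>-th c.e. set.
\<close>

definition ax :: "nat \<Rightarrow> fm set" where
  "ax e = {\<phi>. gn \<phi> \<in> ce_set e}"

definition theory_index :: "lang \<Rightarrow> nat \<Rightarrow> bool" where
  "theory_index L e \<longleftrightarrow> ce_set e \<subseteq> gn ` sentences L"

definition strongly_doubly_generative :: "lang \<Rightarrow> fm set \<Rightarrow> fm set \<Rightarrow> bool" where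
  "strongly_doubly_generative L U X \<longleftrightarrow>
     (\<exists>\<Phi>. total_computable2 \<Phi> \<and>
       (\<forall>i j. ce_set i \<inter> ce_set j = {} \<longrightarrow>
          (\<Phi> i j \<in> gn ` provable_set L {} \<longleftrightarrow> \<Phi> i j \<in> ce_set j) \<and>
          (\<Phi> i j \<in> gn ` refutable_set L U \<longleftrightarrow> \<Phi> i j \<in> ce_set i) \<and>
          (\<Phi> i j \<notin> ce_set i \<union> ce_set j \<longrightarrow> \<Phi> i j \<in> gn ` X)))"

definition effectively_essentially_hereditarily_creative ::
    "lang \<Rightarrow> fm set \<Rightarrow> fm set \<Rightarrow> bool" where
  "effectively_essentially_hereditarily_creative L U X \<longleftrightarrow>
     (\<exists>\<Phi>. partial_computable3 \<Phi> \<and>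
       (\<forall>i j k. theory_index L k \<and> consistent L (ax k) \<and> subtheory L U (ax k) \<and>
                theory_index L i \<and> subtheory L (ax i) (ax k) \<and>
                gn ` provable_set L (ax i) \<inter> ce_set j = {} \<longrightarrow>
          (\<exists>n. \<Phi> i j k = Some n \<and> n \<in> gn ` X \<and>
               n \<notin> gn ` provable_set L (ax i) \<union> ce_set j)))"

end

theory Submission
  imports Defs
begin

text \<open>
  (a) to (b): given \<open>i\<close> and \<open>j\<close>, apply the generative function to the theorems of \<open>W\<^sub>i\<close> and to
  \<open>W\<^sub>j\<close>. A value that is a theorem of \<open>W\<^sub>i\<close> would be refuted by \<open>U\<close>, contradicting the
  consistency of the common extension; a value in \<open>W\<^sub>j\<close> would be a theorem of pure logic, hence
  of \<open>W\<^sub>i\<close>.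

  (b) to (a): by the recursion theorem, choose \<open>n = \<Phi> a b c\<close> such that \<open>W\<^sub>a\<close> is \<open>{n}\<close> if
  \<open>n \<in> W\<^sub>i\<close> is a sentence and empty otherwise, \<open>W\<^sub>b\<close> consists of the sentences refuted by \<open>U\<close>,
  and of \<open>n\<close> if \<open>n \<in> W\<^sub>j\<close>, and \<open>W\<^sub>c = U \<union> W\<^sub>a\<close>. Were \<open>n \<in> W\<^sub>j\<close> not logically valid, or
  \<open>n \<in> W\<^sub>i\<close> not refuted by \<open>U\<close>, then \<open>a\<close>, \<open>b\<close>, \<open>c\<close> would be admissible for \<open>\<Phi>\<close>, which would
  then have to avoid its own value.

  All index functions needed come from one c.e. set: the facts derivable in a Horn system that
  describes simultaneously the evaluation of programs, substitution, provability from the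
  \<open>e\<close>-th c.e. set, and the self-referential sets above.
\<close>

section \<open>Computable functions and decidable predicates\<close>

abbreviation pair :: "nat \<Rightarrow> nat \<Rightarrow> nat" ("\<langle>_,/ _\<rangle>") where
  "\<langle>a, b\<rangle> \<equiv> prod_encode (a, b)"

abbreviation left :: "nat \<Rightarrow> nat" where "left x \<equiv> fst (prod_decode x)"
abbreviation right :: "nat \<Rightarrow> nat" where "right x \<equiv> snd (prod_decode x)"

named_theorems computable_intros

section \<open>Closure properties of the total computable functions\<close>

lemma total_computableE:
  assumes "total_computable f"
  obtains p where "\<And>x. run p x = Some (f x)"
  using assms unfolding total_computable_def partial_computable_def by blast

lemma total_computableI: "(\<And>x. run p x = Some (f x)) \<Longrightarrow> total_computable f"
  unfolding total_computable_def partial_computable_def by blast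

lemma computable_const [computable_intros]: "total_computable (\<lambda>_. n)"
proof (induction n)
  case 0
  show ?case by (rule total_computableI[of PZero]) simp
next
  case (Suc n)
  then obtain p where "\<And>x. run p x = Some n" by (rule total_computableE) blast
  then show ?case by (intro total_computableI[of "PComp PSucc p"]) simp
qed

lemma computable_id [computable_intros]: "total_computable (\<lambda>w. w)"
  by (rule total_computableI[of "PPair PFst PSnd"]) simp

lemma computable_compose:
  assumes "total_computable f" "total_computable g"
  shows "total_computable (\<lambda>w. f (g w))"
proof -
  obtain p q where "\<And>x. run p x = Some (f x)" "\<And>x. run q x = Some (g x)"
    using assms by (metis total_computableE)
  then show ?thesis by (intro total_computableI[of "PComp p q"]) simp
qed

lemma computable_pair [computable_intros]:
  assumes "total_computable f" "total_computable g"
  shows "total_computable (\<lambda>w. \<langle>f w, g w\<rangle>)"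
proof -
  obtain p q where "\<And>x. run p x = Some (f x)" "\<And>x. run q x = Some (g x)"
    using assms by (metis total_computableE)
  then show ?thesis by (intro total_computableI[of "PPair p q"]) simp
qed

lemma computable_Suc [computable_intros]:
  "total_computable f \<Longrightarrow> total_computable (\<lambda>w. Suc (f w))"
  by (rule computable_compose[of Suc]) (auto intro: total_computableI[of PSucc])

lemma computable_left [computable_intros]:
  "total_computable f \<Longrightarrow> total_computable (\<lambda>w. left (f w))"
  by (rule computable_compose[of left]) (auto intro: total_computableI[of PFst])

lemma computable_right [computable_intros]:
  "total_computable f \<Longrightarrow> total_computable (\<lambda>w. right (f w))"
  by (rule computable_compose[of right]) (auto intro: total_computableI[of PSnd])

text \<open>\<open>PRec\<close> keeps its first component fixed throughout the recursion. Taking the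
  whole input \<open>w\<close> for it lets the start value, the step and the number of steps all
  depend on \<open>w\<close>.\<close>

lemma computable_rec:
  assumes f: "total_computable f" and g: "total_computable (\<lambda>w. g (left w) (left (right w)) (right (right w)))"
    and n: "total_computable n"
  shows "total_computable (\<lambda>w. rec_nat (f w) (g w) (n w))"
proof -
  obtain p where p: "\<And>x. run p x = Some (f x)" by (rule total_computableE[OF f]) blast
  obtain q where q: "\<And>x. run q x = Some (g (left x) (left (right x)) (right (right x)))"
    by (rule total_computableE[OF g]) blast
  have "rec_nat (run p w) (\<lambda>m r. Option.bind r (\<lambda>v. run q \<langle>w, \<langle>m, v\<rangle>\<rangle>)) k
      = Some (rec_nat (f w) (g w) k)" for w k
    by (induction k) (simp_all add: p q)
  then have "total_computable (\<lambda>x. rec_nat (f (left x)) (g (left x)) (right x))"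
    by (intro total_computableI[of "PRec p q"]) (simp add: split_beta)
  from computable_compose[OF this computable_pair[OF computable_id n]] show ?thesis by simp
qed

lemma computable_pred [computable_intros]:
  assumes "total_computable f"
  shows "total_computable (\<lambda>w. f w - 1)"
proof -
  have "rec_nat 0 (\<lambda>m v. m) k = k - 1" for k :: nat by (cases k) auto
  moreover have "total_computable (\<lambda>w. rec_nat 0 (\<lambda>m v. m) (f w))"
    by (rule computable_rec) (intro computable_intros assms)+
  ultimately show ?thesis by simp
qed

lemma computable_add [computable_intros]:
  assumes "total_computable f" "total_computable g"
  shows "total_computable (\<lambda>w. f w + g w)"
proof -
  have "rec_nat n (\<lambda>m v. Suc v) k = n + k" for n k :: nat by (induction k) auto
  moreover have "total_computable (\<lambda>w. rec_nat (f w) (\<lambda>m v. Suc v) (g w))"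
    by (rule computable_rec) (intro computable_intros assms)+
  ultimately show ?thesis by simp
qed

lemma computable_mult [computable_intros]:
  assumes "total_computable f" "total_computable g"
  shows "total_computable (\<lambda>w. f w * g w)"
proof -
  have "rec_nat 0 (\<lambda>m v. v + n) k = n * k" for n k :: nat by (induction k) auto
  moreover have "total_computable (\<lambda>w. rec_nat 0 (\<lambda>m v. v + f w) (g w))"
    by (rule computable_rec)
      (intro computable_intros computable_compose[OF assms(1)] assms)+
  ultimately show ?thesis by simp
qed

lemma computable_diff [computable_intros]:
  assumes "total_computable f" "total_computable g"
  shows "total_computable (\<lambda>w. f w - g w)"
proof -
  have "rec_nat n (\<lambda>m v. v - 1) k = n - k" for n k :: nat by (induction k) auto
  moreover have "total_computable (\<lambda>w. rec_nat (f w) (\<lambda>m v. v - 1) (g w))"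
    by (rule computable_rec) (intro computable_intros assms)+
  ultimately show ?thesis by simp
qed

text \<open>The value \<open>0\<close> stands for truth because \<^const>\<open>PMin\<close> searches for zeros.\<close>

definition decidable :: "(nat \<Rightarrow> bool) \<Rightarrow> bool" where
  "decidable P \<longleftrightarrow> total_computable (\<lambda>w. if P w then 0 else 1)"

text \<open>A conditional is a recursion of length 0 or 1: the truth value 0 stops at
  \<open>f w\<close>, the value 1 takes one step, which returns \<open>g w\<close>.\<close>

lemma computable_if [computable_intros]:
  assumes P: "decidable P" and f: "total_computable f" and g: "total_computable g"
  shows "total_computable (\<lambda>w. if P w then f w else g w)"
proof -
  have "total_computable (\<lambda>w. rec_nat (f w) (\<lambda>_ _. g w) (if P w then 0 else 1))"
    by (rule computable_rec)
      (intro f computable_compose[OF g] computable_intros P[unfolded decidable_def])+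
  moreover have "rec_nat (f w) (\<lambda>_ _. g w) (if P w then 0 else 1) = (if P w then f w else g w)" for w
    by simp
  ultimately show ?thesis by (simp only:)
qed

lemma decidable_not [computable_intros]:
  assumes "decidable P" shows "decidable (\<lambda>w. \<not> P w)"
proof -
  have "total_computable (\<lambda>w. if P w then 1 else 0)"
    by (intro computable_intros assms)
  moreover have "(if P w then 1 else 0) = (if \<not> P w then 0 else (1::nat))" for w
    by simp
  ultimately show ?thesis unfolding decidable_def by (simp only:)
qed

lemma decidable_conj [computable_intros]:
  assumes "decidable P" "decidable Q" shows "decidable (\<lambda>w. P w \<and> Q w)"
proof -
  have "total_computable (\<lambda>w. if P w then (if Q w then 0 else 1) else 1)"
    by (intro computable_intros assms)
  moreover have "(if P w then (if Q w then 0 else 1) else 1) = (if P w \<and> Q w then 0 else (1::nat))" for w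
    by simp
  ultimately show ?thesis unfolding decidable_def by (simp only:)
qed

lemma decidable_le [computable_intros]:
  assumes "total_computable f" "total_computable g"
  shows "decidable (\<lambda>w. f w \<le> g w)"
proof -
  have "total_computable (\<lambda>w. 1 - (1 - (f w - g w)))"
    by (intro computable_intros assms)
  moreover have "1 - (1 - (f w - g w)) = (if f w \<le> g w then 0 else 1)" for w by auto
  ultimately show ?thesis unfolding decidable_def by (simp only:)
qed

lemma decidable_eq [computable_intros]:
  assumes "total_computable f" "total_computable g"
  shows "decidable (\<lambda>w. f w = g w)"
proof -
  have "decidable (\<lambda>w. f w \<le> g w \<and> g w \<le> f w)"
    by (intro computable_intros assms)
  moreover have "f w \<le> g w \<and> g w \<le> f w \<longleftrightarrow> f w = g w" for w by auto
  ultimately show ?thesis by (simp only:)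
qed

lemma decidable_compose:
  "decidable P \<Longrightarrow> total_computable f \<Longrightarrow> decidable (\<lambda>w. P (f w))"
  unfolding decidable_def by (rule computable_compose)

text \<open>The accumulator starts at 0 and stays at 1 once some \<open>P w n\<close> fails.\<close>

lemma decidable_all_less:
  assumes P: "decidable (\<lambda>w. P (left w) (right w))" and b: "total_computable b"
  shows "decidable (\<lambda>w. \<forall>n<b w. P w n)"
proof -
  have "decidable (\<lambda>w. P (left w) (left (right w)))"
    using decidable_compose[OF P, of "\<lambda>w. \<langle>left w, left (right w)\<rangle>"]
    by (simp add: computable_intros)
  then have "total_computable (\<lambda>w. rec_nat 0 (\<lambda>n v. if P w n then v else 1) (b w))"
    by (intro computable_rec[OF computable_const computable_if b] computable_intros)
  moreover have "rec_nat 0 (\<lambda>n v. if P w n then v else 1) k = (if \<forall>n<k. P w n then 0 else (1::nat))" for w k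
    by (induction k) (auto simp: less_Suc_eq)
  ultimately show ?thesis unfolding decidable_def by (simp only:)
qed

lemma decidable_ex_less:
  assumes "decidable (\<lambda>w. P (left w) (right w))" and "total_computable b"
  shows "decidable (\<lambda>w. \<exists>n<b w. P w n)"
proof -
  have "decidable (\<lambda>w. \<not> (\<forall>n<b w. \<not> P w n))"
    by (intro decidable_not[OF decidable_all_less] computable_intros assms)
  then show ?thesis by simp
qed

text \<open>\<open>PMin\<close> applied to the truth value of \<open>P\<close> converges exactly
  when a witness exists; the truth value is total, so convergence below the witness is
  automatic.\<close>

lemma ce_ex_decidable:
  assumes "decidable (\<lambda>w. P (left w) (right w))"
  shows "ce {x. \<exists>n. P x n}"
proof -
  obtain p where p: "\<And>w. run p w = Some (if P (left w) (right w) then 0 else 1)"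
    by (rule total_computableE[OF assms[unfolded decidable_def]]) blast
  obtain e where "prog_of e = PMin p" using surj_prog_of by blast
  then have "ce_set e = {x. \<exists>n. P x n}"
    by (auto simp: ce_set_def Let_def p split: if_splits)
  then show ?thesis unfolding ce_def by blast
qed

section \<open>Finite sequences coded by iterated pairing\<close>

primrec entry :: "nat \<Rightarrow> nat \<Rightarrow> nat" where
  "entry 0 s = left s"
| "entry (Suc n) s = entry n (right s)"

text \<open>The end of the list leaves no mark, and \<open>entry\<close> is defined at every
  position of every number, so a length must be stored separately where it matters.\<close>

primrec tuple :: "nat list \<Rightarrow> nat" where
  "tuple [] = 0"
| "tuple (x # xs) = \<langle>x, tuple xs\<rangle>"

lemma entry_tuple: "n < length xs \<Longrightarrow> entry n (tuple xs) = xs ! n"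
  by (induction xs arbitrary: n) (auto simp: less_Suc_eq_0_disj)

lemma computable_entry [computable_intros]:
  assumes "total_computable f" "total_computable g"
  shows "total_computable (\<lambda>w. entry (f w) (g w))"
proof -
  \<comment> \<open>\<open>entry\<close> applies \<open>right\<close> on the way in, the recursion
    applies it last; this commutation reconciles the two.\<close>
  have *: "right (rec_nat s (\<lambda>_ v. right v) k) = rec_nat (right s) (\<lambda>_ v. right v) k" for k s
    by (induction k) simp_all
  have "entry k s = left (rec_nat s (\<lambda>_ v. right v) k)" for k s
    by (induction k arbitrary: s) (simp_all add: *)
  moreover have "total_computable (\<lambda>w. left (rec_nat (g w) (\<lambda>_ v. right v) (f w)))"
    by (rule computable_left, rule computable_rec) (intro computable_intros assms)+
  ultimately show ?thesis by simp
qed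

section \<open>Horn systems\<close>

text \<open>A rule maps each natural number to an instance (premises, conclusion); the binder
  peels off the components of that number, one for each variable of the clause.\<close>

type_synonym 'f rule = "nat \<Rightarrow> 'f list \<times> 'f"

definition for_all :: "(nat \<Rightarrow> 'f rule) \<Rightarrow> 'f rule" (binder "\<Pi>" 10) where
  "(\<Pi> a. R a) = (\<lambda>w. R (left w) (right w))"

definition clause :: "'f list \<Rightarrow> 'f \<Rightarrow> 'f rule" (infix "\<turnstile>" 50) where
  "ps \<turnstile> c = (\<lambda>_. (ps, c))"

definition closed_under :: "('f \<Rightarrow> bool) \<Rightarrow> 'f rule \<Rightarrow> bool" where
  "closed_under D r \<longleftrightarrow> (\<forall>w. list_all D (fst (r w)) \<longrightarrow> D (snd (r w)))"

lemma closed_under_for_all [simp]: "closed_under D (\<Pi> a. R a) \<longleftrightarrow> (\<forall>a. closed_under D (R a))"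
proof -
  have "(\<forall>w. Q (left w) (right w)) \<longleftrightarrow> (\<forall>a b. Q a b)" for Q :: "nat \<Rightarrow> nat \<Rightarrow> bool"
    by (metis fst_conv snd_conv prod_encode_inverse)
  from this[of "\<lambda>a b. list_all D (fst (R a b)) \<longrightarrow> D (snd (R a b))"]
  show ?thesis unfolding closed_under_def for_all_def .
qed

lemma closed_under_clause [simp]: "closed_under D (ps \<turnstile> c) \<longleftrightarrow> (list_all D ps \<longrightarrow> D c)"
  by (simp add: closed_under_def clause_def)

inductive derivable :: "'f rule list \<Rightarrow> 'f \<Rightarrow> bool" for rs where
  step: "r \<in> set rs \<Longrightarrow> \<forall>p \<in> set (fst (r w)). derivable rs p \<Longrightarrow> derivable rs (snd (r w))"

lemma closed_under_derivable: "list_all (closed_under (derivable rs)) rs"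
  by (auto simp: list_all_iff closed_under_def intro: derivable.step)

text \<open>Soundness will come from this induction principle, with the intended meaning for
  \<open>D\<close>; completeness from the closure of \<open>derivable\<close> itself.\<close>

lemma derivable_least:
  assumes "derivable rs f" "list_all (closed_under D) rs"
  shows "D f"
  using assms(1)
proof induction
  case (step r w)
  then have "closed_under D r" using assms(2) by (auto simp: list_all_iff)
  then show ?case using step by (simp add: closed_under_def list_all_iff)
qed

definition rule_code :: "('f \<Rightarrow> nat) \<Rightarrow> 'f rule \<Rightarrow> nat \<Rightarrow> nat" where
  "rule_code c r w =
     \<langle>c (snd (r w)), \<langle>length (fst (r w)), tuple (map c (fst (r w)))\<rangle>\<rangle>"

text \<open>Induction on the finite list. The default \<open>g\<close> covers indices beyond its end
  and is arbitrary, because it changes along the induction.\<close>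

lemma computable_nth_rule:
  assumes "list_all (\<lambda>r. total_computable (rule_code c r)) rs" "total_computable g"
  shows "total_computable (\<lambda>w. if left w < length rs then rule_code c (rs ! left w) (right w) else g w)"
  using assms
proof (induction rs arbitrary: g)
  case Nil
  then show ?case by simp
next
  case (Cons r rs)
  \<comment> \<open>The tail is indexed from 0 again, so the default raises the index by one before
    passing it to \<open>g\<close>.\<close>
  define h where "h w = (if left w < length rs then rule_code c (rs ! left w) (right w)
    else g \<langle>Suc (left w), right w\<rangle>)" for w
  have h: "total_computable h"
    unfolding h_def using Cons.prems(1)
    by (intro Cons.IH computable_compose[OF Cons.prems(2)] computable_intros) simp
  have "total_computable (\<lambda>w. if left w = 0 then rule_code c r (right w) else h \<langle>left w - 1, right w\<rangle>)"
    using Cons.prems(1)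
    by (intro computable_compose[OF h] computable_compose[of "rule_code c r" right] computable_intros) simp
  moreover have "(if left w = 0 then rule_code c r (right w) else h \<langle>left w - 1, right w\<rangle>) =
    (if left w < length (r # rs) then rule_code c ((r # rs) ! left w) (right w) else g w)" for w
  proof (cases "left w")
    case (Suc n)
    then have "\<langle>Suc n, right w\<rangle> = w" by (metis prod.collapse prod_decode_inverse)
    then show ?thesis using Suc by (simp add: h_def)
  qed simp
  ultimately show ?case by (simp only:)
qed

text \<open>A derivation is a list of rule instances whose premises are conclusions of earlier ones;
  such lists are quantified over as tuples of natural numbers.\<close>

lemma ce_derivable:
  assumes rs: "list_all (\<lambda>r. total_computable (rule_code c r)) rs" "rs \<noteq> []"
    and inj: "inj c"
  shows "ce {x. \<exists>f. derivable rs f \<and> c f = x}"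
proof -
  \<comment> \<open>A number is read as a rule index paired with an instance number. An index out of
    range falls back on the first rule, so every number denotes an instance.\<close>
  define E where "E w = (if left w < length rs then rule_code c (rs ! left w) (right w)
    else rule_code c (hd rs) w)" for w
  have E: "total_computable E"
    unfolding E_def using rs by (intro computable_nth_rule) (cases rs; auto)+
  define ok where "ok s n \<longleftrightarrow> (\<forall>k < left (right (E (entry n s))).
    \<exists>m<n. left (E (entry m s)) = entry k (right (right (E (entry n s)))))" for s n
  \<comment> \<open>\<open>d\<close> pairs the position of the last step with the coded sequence of
    steps.\<close>
  define valid where "valid x d \<longleftrightarrow> left (E (entry (left d) (right d))) = x \<and>
    (\<forall>n < Suc (left d). ok (right d) n)" for x d
  have Es: "\<exists>r w'. r \<in> set rs \<and> E w = rule_code c r w'" for w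
    using rs(2) by (auto simp: E_def intro: nth_mem hd_in_set)
  have sE: "\<exists>w. E w = rule_code c r w'" if "r \<in> set rs" for r w'
  proof -
    obtain i where "i < length rs" "rs ! i = r" using \<open>r \<in> set rs\<close> by (auto simp: in_set_conv_nth)
    then show ?thesis by (intro exI[of _ "\<langle>i, w'\<rangle>"]) (simp add: E_def)
  qed

  \<comment> \<open>Strong induction on the position; injectivity of \<open>c\<close> turns equal
    codes of premise and earlier conclusion into equal facts.\<close>
  have sound: "\<exists>f. derivable rs f \<and> c f = left (E (entry n s))" if "\<forall>n < b. ok s n" "n < b" for s n b
    using that(2)
  proof (induction n rule: less_induct)
    case (less n)
    obtain r w where r: "r \<in> set rs" "E (entry n s) = rule_code c r w" using Es by blast
    have "derivable rs p" if p: "p \<in> set (fst (r w))" for p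
    proof -
      obtain k where k: "k < length (fst (r w))" "p = fst (r w) ! k"
        using p by (auto simp: in_set_conv_nth)
      have "ok s n" using that(1) less.prems \<open>\<forall>n < b. ok s n\<close> by simp
      then obtain m where m: "m < n" "left (E (entry m s)) = c p"
        using k r by (auto simp: ok_def rule_code_def entry_tuple)
      then obtain f where "derivable rs f" "c f = c p" using less by fastforce
      then show ?thesis using inj by (simp add: inj_eq)
    qed
    then have "derivable rs (snd (r w))" using r(1) by (auto intro: derivable.step)
    then show ?case using r by (auto simp: rule_code_def)
  qed

  \<comment> \<open>The condition \<open>ok\<close> for lists instead of coded sequences, so that
    derivations can be concatenated.\<close>
  define der where "der xs \<longleftrightarrow> (\<forall>n < length xs. \<forall>k < left (right (E (xs ! n))).
    \<exists>m<n. left (E (xs ! m)) = entry k (right (right (E (xs ! n)))))" for xs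
  have der_append: "der (xs @ ys)" if "der xs" "der ys" for xs ys
    unfolding der_def
  proof (intro allI impI)
    fix n k assume n: "n < length (xs @ ys)" and k: "k < left (right (E ((xs @ ys) ! n)))"
    show "\<exists>m<n. left (E ((xs @ ys) ! m)) = entry k (right (right (E ((xs @ ys) ! n))))"
    proof (cases "n < length xs")
      case True
      then have "\<exists>m<n. left (E (xs ! m)) = entry k (right (right (E (xs ! n))))"
        using \<open>der xs\<close> k by (simp add: der_def nth_append)
      then obtain m where "m < n" "left (E (xs ! m)) = entry k (right (right (E (xs ! n))))" by blast
      then show ?thesis using True by (intro exI[of _ m]) (simp add: nth_append)
    next
      case False
      define n' where "n' = n - length xs"
      have n': "n = length xs + n'" "n' < length ys" using False n by (auto simp: n'_def)
      then obtain m where "m < n'" "left (E (ys ! m)) = entry k (right (right (E (ys ! n'))))"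
        using \<open>der ys\<close> k by (auto simp: der_def nth_append)
      then show ?thesis using n' by (intro exI[of _ "length xs + m"]) (simp add: nth_append)
    qed
  qed
  have complete: "\<exists>xs x. der (xs @ [x]) \<and> left (E x) = c f" if "derivable rs f" for f
    using that
  proof induction
    case (step r w)
    \<comment> \<open>Derivations of the premises are concatenated one premise at a time; the
      instance itself is appended afterwards as the last step.\<close>
    have "\<exists>xs. der xs \<and> (\<forall>p \<in> set qs. \<exists>m < length xs. left (E (xs ! m)) = c p)"
      if "\<forall>p \<in> set qs. \<exists>xs x. der (xs @ [x]) \<and> left (E x) = c p" for qs
      using that
    proof (induction qs)
      case Nil
      show ?case by (intro exI[of _ "[]"]) (simp add: der_def)
    next
      case (Cons q qs)
      then obtain xs where xs: "der xs" "\<forall>p \<in> set qs. \<exists>m < length xs. left (E (xs ! m)) = c p" by auto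
      obtain ys y where y: "der (ys @ [y])" "left (E y) = c q" using Cons.prems by auto
      have "\<exists>m < length (xs @ ys @ [y]). left (E ((xs @ ys @ [y]) ! m)) = c p"
        if p: "p \<in> set (q # qs)" for p
      proof (cases "p = q")
        case True
        then show ?thesis using y by (intro exI[of _ "length xs + length ys"]) (simp add: nth_append)
      next
        case False
        then obtain m where "m < length xs" "left (E (xs ! m)) = c p" using xs p by auto
        then show ?thesis by (intro exI[of _ m]) (simp add: nth_append)
      qed
      then show ?case using der_append[OF xs(1) y(1)] by blast
    qed
    then obtain xs where xs: "der xs" "\<forall>p \<in> set (fst (r w)). \<exists>m < length xs. left (E (xs ! m)) = c p"
      using step(2) by meson
    obtain x where x: "E x = rule_code c r w" using sE step(1) by blast
    have "\<exists>m < length xs. left (E (xs ! m)) = c (fst (r w) ! k)" if "k < length (fst (r w))" for k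
      using xs(2) that by simp
    then have "der (xs @ [x])"
      using xs(1) x
      unfolding der_def
      by (auto simp: nth_append less_Suc_eq rule_code_def entry_tuple) (metis less_trans)+
    moreover have "left (E x) = c (snd (r w))" using x by (simp add: rule_code_def)
    ultimately show ?case by blast
  qed

  have "decidable (\<lambda>w. valid (left w) (right w))"
    unfolding valid_def ok_def
    by (intro computable_intros decidable_all_less decidable_ex_less computable_compose[OF E])
  then have "ce {x. \<exists>d. valid x d}" by (rule ce_ex_decidable)
  moreover have "(\<exists>d. valid x d) \<longleftrightarrow> (\<exists>f. derivable rs f \<and> c f = x)" for x
  proof
    assume "\<exists>d. valid x d"
    then show "\<exists>f. derivable rs f \<and> c f = x"
      using sound unfolding valid_def by blast
  next
    assume "\<exists>f. derivable rs f \<and> c f = x"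
    then obtain xs y where y: "der (xs @ [y])" "left (E y) = x" using complete by blast
    define s where "s = tuple (xs @ [y])"
    have s: "entry n s = (xs @ [y]) ! n" if "n < Suc (length xs)" for n
      unfolding s_def using that by (intro entry_tuple) simp
    have "valid x \<langle>length xs, s\<rangle>"
      unfolding valid_def ok_def
    proof (intro conjI allI impI)
      show "left (E (entry (left \<langle>length xs, s\<rangle>) (right \<langle>length xs, s\<rangle>))) = x"
        using y s by simp
      fix n k
      assume "n < Suc (left \<langle>length xs, s\<rangle>)"
        and "k < left (right (E (entry n (right \<langle>length xs, s\<rangle>))))"
      then have n: "n < Suc (length xs)" and k: "k < left (right (E ((xs @ [y]) ! n)))"
        using s by simp_all
      then obtain m where m: "m < n"
          "left (E ((xs @ [y]) ! m)) = entry k (right (right (E ((xs @ [y]) ! n))))"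
        using y(1) unfolding der_def by auto
      then show "\<exists>m<n. left (E (entry m (right \<langle>length xs, s\<rangle>))) =
          entry k (right (right (E (entry n (right \<langle>length xs, s\<rangle>)))))"
        using n s by (intro exI[of _ m]) simp
    qed
    then show "\<exists>d. valid x d" by blast
  qed
  ultimately show ?thesis by simp
qed

section \<open>Evaluation and provability as Horn systems\<close>

text \<open>
  \<open>NonzeroBelow e x n\<close> says that \<open>e\<close> converges to nonzero values on \<open>\<langle>x, m\<rangle>\<close> for \<open>m < n\<close>.
  \<open>OpTm k m s t\<close>, \<open>OpTms k m n ss ts\<close> (lists of length \<open>n - 1\<close>) and \<open>OpFm k m p q\<close> say that the
  first code is well formed and that the second one results from it by lifting at \<open>k\<close>, if
  \<open>m = 0\<close>, or by substituting the term with code \<open>m - 1\<close> for \<open>k\<close>.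
  In \<open>SelfI q x\<close>, \<open>SelfJ q x\<close>, \<open>SelfK q x\<close> the number \<open>q = \<langle>z, \<langle>i, j\<rangle>\<rangle>\<close> carries a program \<open>z\<close>
  that is run on \<open>q\<close> itself, as in the proof of the recursion theorem; they define the sets
  \<open>W\<^sub>a\<close>, \<open>W\<^sub>b\<close> and \<open>W\<^sub>c\<close> of the introduction.
\<close>

datatype fact =
    Run nat nat nat
  | NonzeroBelow nat nat nat
  | OpTm nat nat nat nat
  | OpTms nat nat nat nat nat
  | OpFm nat nat nat nat
  | WfTm nat
  | WfFm nat
  | Sentence nat
  | Prv nat nat
  | Thm nat nat
  | SelfI nat nat
  | SelfJ nat nat
  | SelfK nat nat

primrec fact_code :: "fact \<Rightarrow> nat" where
  "fact_code (Run e x y) = tuple [0, e, x, y]"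
| "fact_code (NonzeroBelow e x n) = tuple [1, e, x, n]"
| "fact_code (OpTm k m s t) = tuple [2, k, m, s, t]"
| "fact_code (OpTms k m n ss ts) = tuple [3, k, m, n, ss, ts]"
| "fact_code (OpFm k m p q) = tuple [4, k, m, p, q]"
| "fact_code (WfTm t) = tuple [5, t]"
| "fact_code (WfFm p) = tuple [6, p]"
| "fact_code (Sentence p) = tuple [7, p]"
| "fact_code (Prv e p) = tuple [8, e, p]"
| "fact_code (Thm e p) = tuple [9, e, p]"
| "fact_code (SelfI q x) = tuple [10, q, x]"
| "fact_code (SelfJ q x) = tuple [11, q, x]"
| "fact_code (SelfK q x) = tuple [12, q, x]"

lemma inj_fact_code: "inj fact_code"
proof (rule injI)
  fix f g assume "fact_code f = fact_code g"
  then show "f = g" by (cases f; cases g) simp_all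
qed

section \<open>The clauses and their computability\<close>

abbreviation gFls :: nat where "gFls \<equiv> \<langle>0, 0\<rangle>"
abbreviation gEq :: "nat \<Rightarrow> nat \<Rightarrow> nat" where "gEq s t \<equiv> \<langle>1, \<langle>s, t\<rangle>\<rangle>"
abbreviation gRel :: "nat \<Rightarrow> nat \<Rightarrow> nat" where "gRel r ts \<equiv> \<langle>2, \<langle>r, ts\<rangle>\<rangle>"
abbreviation gImp :: "nat \<Rightarrow> nat \<Rightarrow> nat" where "gImp p q \<equiv> \<langle>3, \<langle>p, q\<rangle>\<rangle>"
abbreviation gAll :: "nat \<Rightarrow> nat" where "gAll p \<equiv> \<langle>4, p\<rangle>"
abbreviation gNeg :: "nat \<Rightarrow> nat" where "gNeg p \<equiv> gImp p gFls"

text \<open>The shift by one leaves 0 for numbers that name no symbol. \<open>OpTms\<close> counts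
  with the same shift and never reaches the count 0, so undeclared symbols produce no terms or
  formulas.\<close>

abbreviation arity_code :: "(nat \<Rightarrow> nat option) \<Rightarrow> nat \<Rightarrow> nat" where
  "arity_code ar f \<equiv> case ar f of None \<Rightarrow> 0 | Some k \<Rightarrow> Suc k"

text \<open>The offsets 4 to 7 invert the numbering of \<open>prog_of\<close>. Horn clauses have no
  bounded universal quantifier, so minimization runs through the inductive
  \<open>NonzeroBelow\<close>.\<close>

definition run_rules :: "fact rule list" where
  "run_rules = [
    \<Pi> x. [] \<turnstile> Run 0 x 0,
    \<Pi> x. [] \<turnstile> Run 1 x (Suc x),
    \<Pi> x. [] \<turnstile> Run 2 x (left x),
    \<Pi> x. [] \<turnstile> Run 3 x (right x),
    \<Pi> a b x u v. [Run a x u, Run b x v] \<turnstile> Run (4 * \<langle>a, b\<rangle> + 4) x \<langle>u, v\<rangle>,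
    \<Pi> a b x u v. [Run b x u, Run a u v] \<turnstile> Run (4 * \<langle>a, b\<rangle> + 5) x v,
    \<Pi> a b x v. [Run a x v] \<turnstile> Run (4 * \<langle>a, b\<rangle> + 6) \<langle>x, 0\<rangle> v,
    \<Pi> a b x n v u. [Run (4 * \<langle>a, b\<rangle> + 6) \<langle>x, n\<rangle> v, Run b \<langle>x, \<langle>n, v\<rangle>\<rangle> u] \<turnstile>
      Run (4 * \<langle>a, b\<rangle> + 6) \<langle>x, Suc n\<rangle> u,
    \<Pi> a x. [] \<turnstile> NonzeroBelow a x 0,
    \<Pi> a x n v. [NonzeroBelow a x n, Run a \<langle>x, n\<rangle> (Suc v)] \<turnstile> NonzeroBelow a x (Suc n),
    \<Pi> a x n. [NonzeroBelow a x n, Run a \<langle>x, n\<rangle> 0] \<turnstile> Run (4 * a + 7) x n]"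

text \<open>Comparisons of indices are expressed by addition: \<open>Suc (n + d)\<close> is an
  arbitrary number above \<open>n\<close>. Under a quantifier the substituted term must be lifted,
  which the premise \<open>OpTm 0 0 u v\<close> computes. The last clause recognises sentences as
  the formulas unchanged by lifting at 0.\<close>

definition op_rules :: "lang \<Rightarrow> fact rule list" where
  "op_rules L = [
    \<Pi> n d m. [] \<turnstile> OpTm (Suc (n + d)) m \<langle>0, n\<rangle> \<langle>0, n\<rangle>,
    \<Pi> k d. [] \<turnstile> OpTm k 0 \<langle>0, k + d\<rangle> \<langle>0, Suc (k + d)\<rangle>,
    \<Pi> k u. [] \<turnstile> OpTm k (Suc u) \<langle>0, k\<rangle> u,
    \<Pi> k u d. [] \<turnstile> OpTm k (Suc u) \<langle>0, Suc (k + d)\<rangle> \<langle>0, k + d\<rangle>,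
    \<Pi> k m f ss ts. [OpTms k m (arity_code (fun_arity L) f) ss ts] \<turnstile>
      OpTm k m \<langle>1, \<langle>f, ss\<rangle>\<rangle> \<langle>1, \<langle>f, ts\<rangle>\<rangle>,
    \<Pi> k m. [] \<turnstile> OpTms k m 1 0 0,
    \<Pi> k m n s t ss ts. [OpTm k m s t, OpTms k m n ss ts] \<turnstile>
      OpTms k m (Suc n) (Suc \<langle>s, ss\<rangle>) (Suc \<langle>t, ts\<rangle>),
    \<Pi> k m. [] \<turnstile> OpFm k m gFls gFls,
    \<Pi> k m s s' t t'. [OpTm k m s s', OpTm k m t t'] \<turnstile> OpFm k m (gEq s t) (gEq s' t'),
    \<Pi> k m r ss ts. [OpTms k m (arity_code (rel_arity L) r) ss ts] \<turnstile>
      OpFm k m (gRel r ss) (gRel r ts),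
    \<Pi> k m p p' q q'. [OpFm k m p p', OpFm k m q q'] \<turnstile> OpFm k m (gImp p q) (gImp p' q'),
    \<Pi> k p q. [OpFm (Suc k) 0 p q] \<turnstile> OpFm k 0 (gAll p) (gAll q),
    \<Pi> k u v p q. [OpTm 0 0 u v, OpFm (Suc k) (Suc v) p q] \<turnstile> OpFm k (Suc u) (gAll p) (gAll q),
    \<Pi> s t. [OpTm 0 0 s t] \<turnstile> WfTm s,
    \<Pi> p q. [OpFm 0 0 p q] \<turnstile> WfFm p,
    \<Pi> p. [OpFm 0 0 p p] \<turnstile> Sentence p]"

text \<open>Results of substitution and lifting are supplied by \<open>OpFm\<close> premises. The
  first clause accepts every element of the \<open>e\<close>-th c.e. set as an axiom, even one that
  codes no formula.\<close>

definition prv_rules :: "fact rule list" where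
  "prv_rules = [
    \<Pi> e p y. [Run e p y] \<turnstile> Prv e p,
    \<Pi> e p q. [WfFm p, WfFm q] \<turnstile> Prv e (gImp p (gImp q p)),
    \<Pi> e p q r. [WfFm p, WfFm q, WfFm r] \<turnstile>
      Prv e (gImp (gImp p (gImp q r)) (gImp (gImp p q) (gImp p r))),
    \<Pi> e p. [WfFm p] \<turnstile> Prv e (gImp (gNeg (gNeg p)) p),
    \<Pi> e p q t. [WfFm p, WfTm t, OpFm 0 (Suc t) p q] \<turnstile> Prv e (gImp (gAll p) q),
    \<Pi> e p q. [WfFm p, WfFm q] \<turnstile> Prv e (gImp (gAll (gImp p q)) (gImp (gAll p) (gAll q))),
    \<Pi> e p q. [WfFm p, OpFm 0 0 p q] \<turnstile> Prv e (gImp p (gAll q)),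
    \<Pi> e t. [WfTm t] \<turnstile> Prv e (gEq t t),
    \<Pi> e s t p q r. [WfTm s, WfTm t, WfFm p, OpFm 0 (Suc s) p q, OpFm 0 (Suc t) p r] \<turnstile>
      Prv e (gImp (gEq s t) (gImp q r)),
    \<Pi> e p q. [Prv e (gImp p q), Prv e p] \<turnstile> Prv e q,
    \<Pi> e p. [Prv e p] \<turnstile> Prv e (gAll p),
    \<Pi> e p. [Prv e p, Sentence p] \<turnstile> Thm e p]"

text \<open>Membership in a c.e. set is a \<open>Run\<close> premise with arbitrary output
  \<open>y\<close>. The premise \<open>Sentence x\<close> of the first clause makes the set given by
  \<open>SelfI\<close> a set of sentences for every \<open>i\<close>.\<close>

definition self_rules :: "nat \<Rightarrow> fact rule list" where
  "self_rules u = [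
    \<Pi> z i j x y. [Run z \<langle>z, \<langle>i, j\<rangle>\<rangle> x, Run i x y, Sentence x] \<turnstile> SelfI \<langle>z, \<langle>i, j\<rangle>\<rangle> x,
    \<Pi> z i j x y. [Run z \<langle>z, \<langle>i, j\<rangle>\<rangle> x, Run j x y] \<turnstile> SelfJ \<langle>z, \<langle>i, j\<rangle>\<rangle> x,
    \<Pi> q x. [Prv u (gNeg x), Sentence x] \<turnstile> SelfJ q x,
    \<Pi> q x y. [Run u x y] \<turnstile> SelfK q x,
    \<Pi> q x. [SelfI q x] \<turnstile> SelfK q x]"

definition rules :: "lang \<Rightarrow> nat \<Rightarrow> fact rule list" where
  "rules L u = run_rules @ op_rules L @ prv_rules @ self_rules u"

text \<open>All codes are built by pairing, projections and arithmetic, except for the arities in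
  \<open>op_rules\<close>; there the computability of the language enters.\<close>

lemma computable_rules:
  assumes "computable_lang L"
  shows "list_all (\<lambda>r. total_computable (rule_code fact_code r)) (rules L u)"
proof -
  have ar: "total_computable f \<Longrightarrow> total_computable (\<lambda>w. arity_code (fun_arity L) (f w))"
    "total_computable f \<Longrightarrow> total_computable (\<lambda>w. arity_code (rel_arity L) (f w))" for f
    using assms computable_compose unfolding computable_lang_def by fast+
  have "list_all (\<lambda>r. total_computable (\<lambda>w. rule_code fact_code r w)) (rules L u)"
    unfolding rules_def run_rules_def op_rules_def prv_rules_def self_rules_def
    by (simp only: list_all_append list.pred_inject rule_code_def for_all_def clause_def fst_conv snd_conv
        list.map tuple.simps fact_code.simps list.size append.simps)
      (intro conjI TrueI computable_intros ar)
  then show ?thesis by simp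
qed

section \<open>Completeness of the clauses\<close>

lemma prog_of_small: "prog_of 0 = PZero" "prog_of (Suc 0) = PSucc" "prog_of 2 = PFst" "prog_of 3 = PSnd"
  by (simp_all add: prog_of.simps)

lemma prog_of_compound:
  "prog_of (4 * \<langle>a, b\<rangle> + 4) = PPair (prog_of a) (prog_of b)"
  "prog_of (4 * \<langle>a, b\<rangle> + 5) = PComp (prog_of a) (prog_of b)"
  "prog_of (4 * \<langle>a, b\<rangle> + 6) = PRec (prog_of a) (prog_of b)"
  "prog_of (4 * a + 7) = PMin (prog_of a)"
  by (subst prog_of.simps, simp add: Let_def Suc_mult4_div_mod)+

lemma index_cases:
  obtains "e = 0" | "e = 1" | "e = 2" | "e = 3"
  | a b where "e = 4 * \<langle>a, b\<rangle> + 4" | a b where "e = 4 * \<langle>a, b\<rangle> + 5"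
  | a b where "e = 4 * \<langle>a, b\<rangle> + 6" | a where "e = 4 * a + 7"
proof -
  have "e < 4 \<or> (\<exists>q. e = 4 * q + 4 \<or> e = 4 * q + 5 \<or> e = 4 * q + 6 \<or> e = 4 * q + 7)"
    by presburger
  moreover have "\<exists>a b. q = \<langle>a, b\<rangle>" for q
    by (metis prod_decode_inverse surj_pair)
  moreover have "e < 4 \<longleftrightarrow> e = 0 \<or> e = 1 \<or> e = 2 \<or> e = 3" by auto
  ultimately show ?thesis using that by metis
qed

text \<open>Induction on the program, the shape of its index being recovered by
  \<open>index_cases\<close>. \<open>D\<close> will be derivability in the whole system, which is
  closed under these clauses among others.\<close>

lemma run_rules_complete:
  assumes "list_all (closed_under D) run_rules" and "run (prog_of e) x = Some y"
  shows "D (Run e x y)"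
proof -
  note closed = assms(1)[unfolded run_rules_def, simplified]
  have comp: "D (Run b x u) \<Longrightarrow> D (Run a u v) \<Longrightarrow> D (Run (4 * \<langle>a, b\<rangle> + 5) x v)" for a b x u v
    using closed by metis
  have rec: "D (Run (4 * \<langle>a, b\<rangle> + 6) \<langle>x, n\<rangle> v) \<Longrightarrow> D (Run b \<langle>x, \<langle>n, v\<rangle>\<rangle> u) \<Longrightarrow>
      D (Run (4 * \<langle>a, b\<rangle> + 6) \<langle>x, Suc n\<rangle> u)" for a b x n v u
    using closed by metis
  have below: "D (NonzeroBelow a x n) \<Longrightarrow> D (Run a \<langle>x, n\<rangle> (Suc v)) \<Longrightarrow> D (NonzeroBelow a x (Suc n))"
    for a x n v
    using closed by metis
  have min: "D (NonzeroBelow a x n) \<Longrightarrow> D (Run a \<langle>x, n\<rangle> 0) \<Longrightarrow> D (Run (4 * a + 7) x n)" for a x n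
    using closed by metis
  show ?thesis using assms(2)
  proof (induction "prog_of e" arbitrary: e x y)
    case PZero
    then show ?case using closed
      by (cases e rule: index_cases) (auto simp: prog_of_compound prog_of_small)
  next
    case PSucc
    then show ?case using closed
      by (cases e rule: index_cases) (auto simp: prog_of_compound prog_of_small)
  next
    case PFst
    then show ?case using closed
      by (cases e rule: index_cases) (auto simp: prog_of_compound prog_of_small)
  next
    case PSnd
    then show ?case using closed
      by (cases e rule: index_cases) (auto simp: prog_of_compound prog_of_small)
  next
    case (PPair f g)
    then obtain a b where e: "e = 4 * \<langle>a, b\<rangle> + 4" "f = prog_of a" "g = prog_of b"
      by (cases e rule: index_cases) (auto simp: prog_of_compound prog_of_small)
    obtain v w where "run f x = Some v" "run g x = Some w" "y = \<langle>v, w\<rangle>"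
      using PPair.prems e by (auto simp: prog_of_compound bind_eq_Some_conv)
    then show ?case using PPair.hyps(1)[OF e(2)] PPair.hyps(2)[OF e(3)] e closed by simp
  next
    case (PComp f g)
    then obtain a b where e: "e = 4 * \<langle>a, b\<rangle> + 5" "f = prog_of a" "g = prog_of b"
      by (cases e rule: index_cases) (auto simp: prog_of_compound prog_of_small)
    obtain v where v: "run (prog_of b) x = Some v" "run (prog_of a) v = Some y"
      using PComp.prems e by (auto simp: prog_of_compound bind_eq_Some_conv)
    show ?case unfolding e(1)
      by (rule comp[OF PComp.hyps(2)[OF e(3) v(1)] PComp.hyps(1)[OF e(2) v(2)]])
  next
    case (PRec f g)
    then obtain a b where e: "e = 4 * \<langle>a, b\<rangle> + 6" "f = prog_of a" "g = prog_of b"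
      by (cases e rule: index_cases) (auto simp: prog_of_compound prog_of_small)
    \<comment> \<open>Inner induction on the recursion depth \<open>n\<close>.\<close>
    have "D (Run e \<langle>z, n\<rangle> y)"
      if "rec_nat (run f z) (\<lambda>m r. Option.bind r (\<lambda>v. run g \<langle>z, \<langle>m, v\<rangle>\<rangle>)) n = Some y" for z n y
      using that
    proof (induction n arbitrary: y)
      case 0
      then show ?case using PRec.hyps(1)[OF e(2)] e closed by simp
    next
      case (Suc n)
      then obtain v where v: "D (Run e \<langle>z, n\<rangle> v)" "run (prog_of b) \<langle>z, \<langle>n, v\<rangle>\<rangle> = Some y"
        using e(3) by (auto simp: bind_eq_Some_conv)
      show ?case using v(1) unfolding e(1) by (rule rec[OF _ PRec.hyps(2)[OF e(3) v(2)]])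
    qed
    from this[of "left x" "right x" y] show ?case
      using PRec.prems e by (simp add: prog_of_compound split_beta)
  next
    case (PMin f)
    then obtain a where e: "e = 4 * a + 7" "f = prog_of a"
      by (cases e rule: index_cases) (auto simp: prog_of_compound prog_of_small)
    define P where "P n \<longleftrightarrow> run f \<langle>x, n\<rangle> = Some 0 \<and> (\<forall>m<n. run f \<langle>x, m\<rangle> \<noteq> None)" for n
    have "\<exists>n. P n" and y: "y = (LEAST n. P n)"
      using PMin.prems e by (auto simp: prog_of_compound P_def Let_def split: if_splits)
    then have Py: "P y" by (auto intro: LeastI)
    \<comment> \<open>Below the least zero \<open>y\<close> every value is defined, by
      \<open>P y\<close>, and different from 0, by minimality.\<close>
    have *: "D (NonzeroBelow a x n)" if "n \<le> y" for n
      using that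
    proof (induction n)
      case 0
      then show ?case using closed by simp
    next
      case (Suc n)
      then have "\<not> P n" using not_less_Least[of n P] y by simp
      moreover have conv: "run f \<langle>x, m\<rangle> \<noteq> None" if "m < y" for m using Py that by (simp add: P_def)
      ultimately have "run f \<langle>x, n\<rangle> \<noteq> Some 0" using Suc.prems by (auto simp: P_def)
      moreover have "run f \<langle>x, n\<rangle> \<noteq> None" using Suc.prems conv by simp
      ultimately obtain v where "run f \<langle>x, n\<rangle> = Some (Suc v)"
        by (metis not0_implies_Suc option.exhaust)
      then have "D (Run a \<langle>x, n\<rangle> (Suc v))" using PMin.hyps(1)[OF e(2)] e by simp
      then show ?case using Suc by (auto intro: below)
    qed
    have "D (Run a \<langle>x, y\<rangle> 0)" using PMin.hyps(1)[OF e(2)] e Py by (simp add: P_def)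
    then show ?case using * e by (auto intro: min)
  qed
qed

lemma map_eq_self_iff: "map f xs = xs \<longleftrightarrow> list_all (\<lambda>x. f x = x) xs"
  by (induction xs) auto

lemma lift_tm_eq_self_iff: "lift_tm k t = t \<longleftrightarrow> closed_tm k t"
  by (induction t) (auto simp: map_eq_self_iff list_all_iff)

text \<open>Lifting at \<open>k\<close> changes exactly the free indices from \<open>k\<close> on.
  With \<open>k = 0\<close> this justifies the clause for \<open>Sentence\<close>.\<close>

lemma lift_fm_eq_self_iff: "lift_fm k \<phi> = \<phi> \<longleftrightarrow> closed_fm k \<phi>"
  by (induction \<phi> arbitrary: k) (auto simp: map_eq_self_iff list_all_iff lift_tm_eq_self_iff)

lemma wf_lift_tm: "wf_tm L t \<Longrightarrow> wf_tm L (lift_tm k t)"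
  by (induction t) (auto simp: list_all_iff)

lemma wf_lift_fm: "wf_fm L \<phi> \<Longrightarrow> wf_fm L (lift_fm k \<phi>)"
  by (induction \<phi> arbitrary: k) (auto simp: list_all_iff wf_lift_tm)

lemma wf_subst_tm: "wf_tm L u \<Longrightarrow> wf_tm L t \<Longrightarrow> wf_tm L (subst_tm k u t)"
  by (induction t) (auto simp: list_all_iff)

lemma wf_subst_fm: "wf_tm L u \<Longrightarrow> wf_fm L \<phi> \<Longrightarrow> wf_fm L (subst_fm k u \<phi>)"
  by (induction \<phi> arbitrary: k u) (auto simp: list_all_iff wf_subst_tm wf_lift_tm)

lemma gn_tm_eq_iff [simp]: "gn_tm s = gn_tm t \<longleftrightarrow> s = t"
  using gn_tm_inject by blast

lemma gn_eq_iff [simp]: "gn \<phi> = gn \<psi> \<longleftrightarrow> \<phi> = \<psi>"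
  using inj_gn by (simp add: inj_eq)

text \<open>\<open>f\<close> stands for lifting and substitution alike; the second assumption is
  what a term induction provides for the arguments of a symbol.\<close>

lemma op_terms_complete:
  assumes "list_all (closed_under D) (op_rules L)"
    and "\<And>t. t \<in> set ts \<Longrightarrow> D (OpTm k m (gn_tm t) (gn_tm (f t)))"
  shows "D (OpTms k m (Suc (length ts)) (list_encode (map gn_tm ts)) (list_encode (map gn_tm (map f ts))))"
  using assms(2)
proof (induction ts)
  case Nil
  show ?case using assms(1)[unfolded op_rules_def, simplified] by simp
next
  case (Cons t ts)
  have *: "D (OpTm k m s t) \<Longrightarrow> D (OpTms k m n ss ts) \<Longrightarrow>
      D (OpTms k m (Suc n) (Suc \<langle>s, ss\<rangle>) (Suc \<langle>t, ts\<rangle>))" for k m n s t ss ts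
    using assms(1)[unfolded op_rules_def, simplified] by simp
  show ?case using Cons *[of k m "gn_tm t" "gn_tm (f t)"] by simp
qed

lemma op_term_complete:
  assumes closed: "list_all (closed_under D) (op_rules L)" and "wf_tm L t"
  shows "D (OpTm k 0 (gn_tm t) (gn_tm (lift_tm k t)))"
    and "D (OpTm k (Suc (gn_tm u)) (gn_tm t) (gn_tm (subst_tm k u t)))"
proof -
  have var: "D (OpTm (Suc (n + d)) m \<langle>0, n\<rangle> \<langle>0, n\<rangle>)"
      "D (OpTm n 0 \<langle>0, n + d\<rangle> \<langle>0, Suc (n + d)\<rangle>)"
      "D (OpTm n (Suc m) \<langle>0, n\<rangle> m)"
      "D (OpTm n (Suc m) \<langle>0, Suc (n + d)\<rangle> \<langle>0, n + d\<rangle>)" for n d m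
    using closed[unfolded op_rules_def, simplified] by simp_all
  have fn: "D (OpTms k m (arity_code (fun_arity L) f) ss ts) \<Longrightarrow>
      D (OpTm k m \<langle>1, \<langle>f, ss\<rangle>\<rangle> \<langle>1, \<langle>f, ts\<rangle>\<rangle>)" for k m f ss ts
    using closed[unfolded op_rules_def, simplified] by simp
  show "D (OpTm k 0 (gn_tm t) (gn_tm (lift_tm k t)))"
    using \<open>wf_tm L t\<close>
  proof (induction t)
    case (Var n)
    show ?case
      using var(1)[of n "k - Suc n" 0] var(2)[of k "n - k"] by (cases "n < k") auto
  next
    case (Fn f ts)
    have "D (OpTms k 0 (Suc (length ts)) (list_encode (map gn_tm ts))
        (list_encode (map gn_tm (map (lift_tm k) ts))))"
      using Fn by (intro op_terms_complete[OF closed]) (auto simp: list_all_iff)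
    then show ?case using Fn.prems fn[of k 0 f] by simp
  qed
  show "D (OpTm k (Suc (gn_tm u)) (gn_tm t) (gn_tm (subst_tm k u t)))"
    using \<open>wf_tm L t\<close>
  proof (induction t)
    case (Var n)
    \<comment> \<open>In the two strict cases the parameter \<open>d\<close> of the clause is the
      gap between \<open>n\<close> and \<open>k\<close> less one.\<close>
    consider "n < k" | "n = k" | "k < n" by linarith
    then show ?case
      using var(1)[of n "k - Suc n" "Suc (gn_tm u)"] var(3)[of k "gn_tm u"]
        var(4)[of k "gn_tm u" "n - Suc k"] by cases auto
  next
    case (Fn f ts)
    have "D (OpTms k (Suc (gn_tm u)) (Suc (length ts)) (list_encode (map gn_tm ts))
        (list_encode (map gn_tm (map (subst_tm k u) ts))))"
      using Fn by (intro op_terms_complete[OF closed]) (auto simp: list_all_iff)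
    then show ?case using Fn.prems fn[of k "Suc (gn_tm u)" f] by simp
  qed
qed

text \<open>Both \<open>k\<close> and \<open>u\<close> vary in the induction, since a quantifier
  raises the index and lifts the substituted term.\<close>

lemma op_formula_complete:
  assumes closed: "list_all (closed_under D) (op_rules L)" and "wf_fm L \<phi>"
  shows "D (OpFm k 0 (gn \<phi>) (gn (lift_fm k \<phi>)))"
    and "wf_tm L u \<Longrightarrow> D (OpFm k (Suc (gn_tm u)) (gn \<phi>) (gn (subst_fm k u \<phi>)))"
proof -
  have fls: "D (OpFm k m gFls gFls)" for k m
    using closed[unfolded op_rules_def, simplified] by simp
  have eq: "D (OpTm k m s s') \<Longrightarrow> D (OpTm k m t t') \<Longrightarrow> D (OpFm k m (gEq s t) (gEq s' t'))" for k m s s' t t'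
    using closed[unfolded op_rules_def, simplified] by simp
  have rel: "D (OpTms k m (arity_code (rel_arity L) r) ss ts) \<Longrightarrow>
      D (OpFm k m (gRel r ss) (gRel r ts))" for k m r ss ts
    using closed[unfolded op_rules_def, simplified] by simp
  have imp: "D (OpFm k m p p') \<Longrightarrow> D (OpFm k m q q') \<Longrightarrow> D (OpFm k m (gImp p q) (gImp p' q'))" for k m p p' q q'
    using closed[unfolded op_rules_def, simplified] by simp
  have all0: "D (OpFm (Suc k) 0 p q) \<Longrightarrow> D (OpFm k 0 (gAll p) (gAll q))" for k p q
    using closed[unfolded op_rules_def, simplified] by simp
  have allS: "D (OpTm 0 0 u v) \<Longrightarrow> D (OpFm (Suc k) (Suc v) p q) \<Longrightarrow> D (OpFm k (Suc u) (gAll p) (gAll q))" for k u v p q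
    using closed[unfolded op_rules_def, simplified] by metis
  note tm = op_term_complete[OF closed]
  show "D (OpFm k 0 (gn \<phi>) (gn (lift_fm k \<phi>)))"
    using \<open>wf_fm L \<phi>\<close>
  proof (induction \<phi> arbitrary: k)
    case (Rel r ts)
    have "D (OpTms k 0 (Suc (length ts)) (list_encode (map gn_tm ts))
        (list_encode (map gn_tm (map (lift_tm k) ts))))"
      using Rel by (intro op_terms_complete[OF closed]) (auto simp: list_all_iff tm)
    then show ?case using Rel.prems rel[of k 0 r] by simp
  qed (use fls eq imp all0 tm in auto)
  show "D (OpFm k (Suc (gn_tm u)) (gn \<phi>) (gn (subst_fm k u \<phi>)))" if "wf_tm L u"
    using \<open>wf_fm L \<phi>\<close> that
  proof (induction \<phi> arbitrary: k u)
    case (Rel r ts)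
    have "D (OpTms k (Suc (gn_tm u)) (Suc (length ts)) (list_encode (map gn_tm ts))
        (list_encode (map gn_tm (map (subst_tm k u) ts))))"
      using Rel by (intro op_terms_complete[OF closed]) (auto simp: list_all_iff tm)
    then show ?case using Rel.prems rel[of k "Suc (gn_tm u)" r] by simp
  next
    case (All \<phi>)
    have "D (OpTm 0 0 (gn_tm u) (gn_tm (lift_tm 0 u)))" using All.prems(2) by (rule tm)
    moreover have "D (OpFm (Suc k) (Suc (gn_tm (lift_tm 0 u))) (gn \<phi>) (gn (subst_fm (Suc k) (lift_tm 0 u) \<phi>)))"
      using All by (simp add: wf_lift_tm)
    ultimately show ?case by (simp add: allS)
  qed (use fls eq imp tm in auto)
qed

lemma wf_complete:
  assumes closed: "list_all (closed_under D) (op_rules L)"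
  shows "wf_tm L t \<Longrightarrow> D (WfTm (gn_tm t))" and "wf_fm L \<phi> \<Longrightarrow> D (WfFm (gn \<phi>))"
    and "\<phi> \<in> sentences L \<Longrightarrow> D (Sentence (gn \<phi>))"
proof -
  have r: "D (OpTm 0 0 s t) \<Longrightarrow> D (WfTm s)" "D (OpFm 0 0 p q) \<Longrightarrow> D (WfFm p)"
    "D (OpFm 0 0 p p) \<Longrightarrow> D (Sentence p)" for s t p q
    using closed[unfolded op_rules_def, simplified] by metis+
  show "wf_tm L t \<Longrightarrow> D (WfTm (gn_tm t))"
    using op_term_complete(1)[OF closed] by (rule r)
  show "wf_fm L \<phi> \<Longrightarrow> D (WfFm (gn \<phi>))"
    using op_formula_complete(1)[OF closed] by (rule r)
  assume "\<phi> \<in> sentences L"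
  then have "wf_fm L \<phi>" "lift_fm 0 \<phi> = \<phi>" by (auto simp: sentences_def lift_fm_eq_self_iff)
  then show "D (Sentence (gn \<phi>))" using op_formula_complete(1)[OF closed, of \<phi> 0] by (simp add: r)
qed

lemma prv_wf: "prv L T \<phi> \<Longrightarrow> T \<subseteq> sentences L \<Longrightarrow> wf_fm L \<phi>"
  by (induction rule: prv.induct) (auto simp: sentences_def wf_subst_fm wf_lift_fm)

lemma closed_under_nth:
  "list_all (closed_under D) rs \<Longrightarrow> i < length rs \<Longrightarrow> closed_under D (rs ! i)"
  by (simp add: list_all_length)

text \<open>Each rule of \<open>prv\<close> has its clause. Nothing is asked of \<open>e\<close>:
  elements of the \<open>e\<close>-th c.e. set that code no formula can only yield further
  facts.\<close>

lemma prv_rules_complete: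
  assumes run: "list_all (closed_under D) run_rules"
    and op: "list_all (closed_under D) (op_rules L)"
    and prv: "list_all (closed_under D) prv_rules"
    and "prv L (ax e) \<phi>"
  shows "D (Prv e (gn \<phi>))"
proof -
  note wf = wf_complete[OF op] and f = op_formula_complete[OF op]
  show ?thesis using \<open>prv L (ax e) \<phi>\<close>
  proof induction
    case (Ax \<phi>)
    then obtain y where y: "run (prog_of e) (gn \<phi>) = Some y" by (auto simp: ax_def ce_set_def)
    have "D (Run e p y) \<Longrightarrow> D (Prv e p)" for p y 
      using closed_under_nth[OF prv, of 0] by (simp add: prv_rules_def) metis
    from this[OF run_rules_complete[OF run y]] show ?case .
  next
    case (K \<phi> \<psi>)
    have "D (WfFm p) \<Longrightarrow> D (WfFm q) \<Longrightarrow> D (Prv e (gImp p (gImp q p)))" for p q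
      using closed_under_nth[OF prv, of 1] by (simp add: prv_rules_def)
    from this[OF K[THEN wf(2)]] show ?case by simp
  next
    case (S \<phi> \<psi> \<chi>)
    have "D (WfFm p) \<Longrightarrow> D (WfFm q) \<Longrightarrow> D (WfFm s) \<Longrightarrow>
        D (Prv e (gImp (gImp p (gImp q s)) (gImp (gImp p q) (gImp p s))))" for p q s
      using closed_under_nth[OF prv, of 2] by (simp add: prv_rules_def)
    from this[OF S[THEN wf(2)]] show ?case by simp
  next
    case (DN \<phi>)
    have "D (WfFm p) \<Longrightarrow> D (Prv e (gImp (gNeg (gNeg p)) p))" for p 
      using closed_under_nth[OF prv, of 3] by (simp add: prv_rules_def)
    from this[OF DN[THEN wf(2)]] show ?case by simp
  next
    case (AllE \<phi> t)
    have "D (WfFm p) \<Longrightarrow> D (WfTm t) \<Longrightarrow> D (OpFm 0 (Suc t) p q) \<Longrightarrow> D (Prv e (gImp (gAll p) q))" for p q t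
      using closed_under_nth[OF prv, of 4] by (simp add: prv_rules_def) metis
    from this[OF wf(2)[OF AllE(1)] wf(1)[OF AllE(2)] f(2)[OF AllE]] show ?case by simp
  next
    case (AllImp \<phi> \<psi>)
    have "D (WfFm p) \<Longrightarrow> D (WfFm q) \<Longrightarrow>
        D (Prv e (gImp (gAll (gImp p q)) (gImp (gAll p) (gAll q))))" for p q
      using closed_under_nth[OF prv, of 5] by (simp add: prv_rules_def)
    from this[OF AllImp[THEN wf(2)]] show ?case by simp
  next
    case (Vac \<phi>)
    have "D (WfFm p) \<Longrightarrow> D (OpFm 0 0 p q) \<Longrightarrow> D (Prv e (gImp p (gAll q)))" for p q
      using closed_under_nth[OF prv, of 6] by (simp add: prv_rules_def)
    from this[OF wf(2)[OF Vac] f(1)[OF Vac]] show ?case by simp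
  next
    case (Refl t)
    have "D (WfTm t) \<Longrightarrow> D (Prv e (gEq t t))" for t 
      using closed_under_nth[OF prv, of 7] by (simp add: prv_rules_def)
    from this[OF wf(1)[OF Refl]] show ?case by simp
  next
    case (Leibniz s t \<phi>)
    have "D (WfTm s) \<Longrightarrow> D (WfTm t) \<Longrightarrow> D (WfFm p) \<Longrightarrow> D (OpFm 0 (Suc s) p q) \<Longrightarrow>
      D (OpFm 0 (Suc t) p r) \<Longrightarrow> D (Prv e (gImp (gEq s t) (gImp q r)))" for p q r s t
      using closed_under_nth[OF prv, of 8] by (simp add: prv_rules_def)
    from this[OF wf(1)[OF Leibniz(1)] wf(1)[OF Leibniz(2)] wf(2)[OF Leibniz(3)]
        f(2)[OF Leibniz(3,1)] f(2)[OF Leibniz(3,2)]]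
    show ?case by simp
  next
    case (MP \<phi> \<psi>)
    have "\<forall>e p q. list_all D [Prv e (gImp p q), Prv e p] \<longrightarrow> D (Prv e q)"
      using prv
      unfolding prv_rules_def list.pred_inject closed_under_for_all closed_under_clause
      by (elim conjE)
    from this[rule_format, of e "gn \<phi>" "gn \<psi>"] show ?case using MP.IH by simp
  next
    case (Gen \<phi>)
    have "D (Prv e p) \<Longrightarrow> D (Prv e (gAll p))" for p 
      using closed_under_nth[OF prv, of 10] by (simp add: prv_rules_def)
    then show ?case using Gen.IH by simp
  qed
qed

section \<open>Soundness of the clauses\<close>

text \<open>In the \<open>Op\<close> facts, an \<open>m\<close> that is neither 0 nor the successor
  of a term code leaves the second code unconstrained. \<open>Prv\<close> and \<open>Thm\<close> are
  conditional because a c.e. set that is no theory may contain numbers that code no formula.\<close>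

primrec meaning :: "lang \<Rightarrow> nat \<Rightarrow> fact \<Rightarrow> bool" where
  "meaning L u (Run e x y) \<longleftrightarrow> run (prog_of e) x = Some y"
| "meaning L u (NonzeroBelow e x n) \<longleftrightarrow> (\<forall>m<n. \<exists>v. run (prog_of e) \<langle>x, m\<rangle> = Some (Suc v))"
| "meaning L u (OpTm k m x y) \<longleftrightarrow> (\<exists>t. x = gn_tm t \<and> wf_tm L t \<and>
    (m = 0 \<longrightarrow> y = gn_tm (lift_tm k t)) \<and> (\<forall>s. m = Suc (gn_tm s) \<longrightarrow> y = gn_tm (subst_tm k s t)))"
| "meaning L u (OpTms k m n xs ys) \<longleftrightarrow> (\<exists>ts. xs = list_encode (map gn_tm ts) \<and>
    n = Suc (length ts) \<and> list_all (wf_tm L) ts \<and>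
    (m = 0 \<longrightarrow> ys = list_encode (map gn_tm (map (lift_tm k) ts))) \<and>
    (\<forall>s. m = Suc (gn_tm s) \<longrightarrow> ys = list_encode (map gn_tm (map (subst_tm k s) ts))))"
| "meaning L u (OpFm k m x y) \<longleftrightarrow> (\<exists>\<phi>. x = gn \<phi> \<and> wf_fm L \<phi> \<and>
    (m = 0 \<longrightarrow> y = gn (lift_fm k \<phi>)) \<and> (\<forall>s. m = Suc (gn_tm s) \<longrightarrow> y = gn (subst_fm k s \<phi>)))"
| "meaning L u (WfTm x) \<longleftrightarrow> (\<exists>t. x = gn_tm t \<and> wf_tm L t)"
| "meaning L u (WfFm x) \<longleftrightarrow> (\<exists>\<phi>. x = gn \<phi> \<and> wf_fm L \<phi>)"
| "meaning L u (Sentence x) \<longleftrightarrow> x \<in> gn ` sentences L"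
| "meaning L u (Prv e x) \<longleftrightarrow> (theory_index L e \<longrightarrow> (\<exists>\<phi>. x = gn \<phi> \<and> prv L (ax e) \<phi>))"
| "meaning L u (Thm e x) \<longleftrightarrow> (theory_index L e \<longrightarrow> x \<in> gn ` provable_set L (ax e))"
| "meaning L u (SelfI q x) \<longleftrightarrow>
    run (prog_of (left q)) q = Some x \<and> x \<in> ce_set (left (right q)) \<and> x \<in> gn ` sentences L"
| "meaning L u (SelfJ q x) \<longleftrightarrow>
    run (prog_of (left q)) q = Some x \<and> x \<in> ce_set (right (right q)) \<or> x \<in> gn ` refutable_set L (ax u)"
| "meaning L u (SelfK q x) \<longleftrightarrow> x \<in> ce_set u \<or>
    run (prog_of (left q)) q = Some x \<and> x \<in> ce_set (left (right q)) \<and> x \<in> gn ` sentences L"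

lemma run_PMinI:
  assumes zero: "run f \<langle>x, n\<rangle> = Some 0" and below: "\<forall>m<n. \<exists>v. run f \<langle>x, m\<rangle> = Some (Suc v)"
  shows "run (PMin f) x = Some n"
proof -
  define P where "P n \<longleftrightarrow> run f \<langle>x, n\<rangle> = Some 0 \<and> (\<forall>m<n. run f \<langle>x, m\<rangle> \<noteq> None)" for n
  have "P n" using assms by (auto simp: P_def)
  moreover have "n \<le> m" if "P m" for m
  proof (rule ccontr)
    assume "\<not> n \<le> m"
    then have "\<exists>v. run f \<langle>x, m\<rangle> = Some (Suc v)" using below by simp
    then show False using that by (simp add: P_def)
  qed
  ultimately have "(LEAST n. P n) = n" "\<exists>n. P n" by (auto intro: Least_equality)
  moreover have "run (PMin f) x = (if \<exists>n. P n then Some (LEAST n. P n) else None)"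
    by (simp add: P_def Let_def)
  ultimately show ?thesis by simp
qed

lemma run_rules_sound: "list_all (closed_under (meaning L u)) run_rules"
  unfolding run_rules_def
  by (auto simp: prog_of_small prog_of_compound less_Suc_eq run_PMinI simp del: run.simps(8))

lemma eq_gn_tm_iff:
  "\<langle>0, n\<rangle> = gn_tm t \<longleftrightarrow> t = Var n"
  "\<langle>Suc 0, \<langle>f, ss\<rangle>\<rangle> = gn_tm t \<longleftrightarrow> (\<exists>ts. t = Fn f ts \<and> ss = list_encode (map gn_tm ts))"
  by (cases t; auto)+

lemma eq_list_encode_iff:
  "0 = list_encode (map gn_tm ts) \<longleftrightarrow> ts = []"
  "Suc \<langle>s, ss\<rangle> = list_encode (map gn_tm ts) \<longleftrightarrow>
    (\<exists>t us. ts = t # us \<and> s = gn_tm t \<and> ss = list_encode (map gn_tm us))"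
  by (cases ts; auto)+

lemma eq_gn_iff:
  "gFls = gn \<phi> \<longleftrightarrow> \<phi> = Fls"
  "\<langle>Suc 0, \<langle>p, q\<rangle>\<rangle> = gn \<phi> \<longleftrightarrow> (\<exists>s t. \<phi> = Eq s t \<and> p = gn_tm s \<and> q = gn_tm t)"
  "gRel r q = gn \<phi> \<longleftrightarrow> (\<exists>ts. \<phi> = Rel r ts \<and> q = list_encode (map gn_tm ts))"
  "gImp p q = gn \<phi> \<longleftrightarrow> (\<exists>\<psi> \<chi>. \<phi> = Imp \<psi> \<chi> \<and> p = gn \<psi> \<and> q = gn \<chi>)"
  "gAll p = gn \<phi> \<longleftrightarrow> (\<exists>\<psi>. \<phi> = All \<psi> \<and> p = gn \<psi>)"
  by (cases \<phi>; auto)+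

lemma inj_gn_tm: "inj gn_tm"
  by (simp add: inj_def)

lemma list_encode_gn_tm_eq_iff [simp]:
  "list_encode (map gn_tm ts) = list_encode (map gn_tm us) \<longleftrightarrow> ts = us"
  by (simp add: list_encode_eq inj_map_eq_map inj_gn_tm)

lemma gn_image_iff [simp]: "gn \<phi> \<in> gn ` A \<longleftrightarrow> \<phi> \<in> A"
  by (simp add: inj_image_mem_iff inj_gn)

lemma op_rules_sound: "list_all (closed_under (meaning L u)) (op_rules L)"
proof -
  \<comment> \<open>Needed for \<open>Sentence\<close>: its premise \<open>OpFm 0 0 p p\<close> says
    that the formula equals its own lifting.\<close>
  have "closed_fm 0 \<phi>" if "\<phi> = lift_fm 0 \<phi>" for \<phi>
    using that by (metis lift_fm_eq_self_iff)
  then show ?thesis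
    unfolding op_rules_def
    by (auto simp: eq_gn_tm_iff eq_list_encode_iff eq_gn_iff sentences_def split: option.splits)
qed

lemma theory_index_cases:
  assumes "theory_index L e" "run (prog_of e) x = Some y"
  obtains \<phi> where "x = gn \<phi>" "\<phi> \<in> ax e"
  using assms by (auto simp: theory_index_def ce_set_def ax_def)

lemma prv_rules_sound: "list_all (closed_under (meaning L u)) prv_rules"
  unfolding prv_rules_def
  by (auto simp: eq_gn_iff provable_set_def intro: prv.intros elim!: theory_index_cases)

text \<open>The assumption discharges the condition in the meaning of \<open>Prv u\<close>, which
  the refutation clause of \<open>SelfJ\<close> has as a premise.\<close>

lemma self_rules_sound:
  assumes "theory_index L u"
  shows "list_all (closed_under (meaning L u)) (self_rules u)"
  using assms unfolding self_rules_def
  by (auto simp: ce_set_def refutable_set_def eq_gn_iff image_iff)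

lemma derivable_sound:
  assumes "theory_index L u" "derivable (rules L u) f"
  shows "meaning L u f"
  using assms(2)
  by (rule derivable_least)
    (simp add: rules_def run_rules_sound op_rules_sound prv_rules_sound self_rules_sound assms(1))

section \<open>Derivability coincides with the intended meaning\<close>

lemma derivable_closed:
  "list_all (closed_under (derivable (rules L u))) run_rules"
  "list_all (closed_under (derivable (rules L u))) (op_rules L)"
  "list_all (closed_under (derivable (rules L u))) prv_rules"
  "list_all (closed_under (derivable (rules L u))) (self_rules u)"
  using closed_under_derivable[of "rules L u"] by (simp_all add: rules_def)

lemma derivable_Thm_iff:
  assumes u: "theory_index L u" and e: "theory_index L e"
  shows "derivable (rules L u) (Thm e x) \<longleftrightarrow> x \<in> gn ` provable_set L (ax e)"
proof
  assume "derivable (rules L u) (Thm e x)"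
  then show "x \<in> gn ` provable_set L (ax e)" using derivable_sound[OF u] e by fastforce
next
  assume "x \<in> gn ` provable_set L (ax e)"
  then obtain \<phi> where \<phi>: "x = gn \<phi>" "\<phi> \<in> sentences L" "prv L (ax e) \<phi>"
    by (auto simp: provable_set_def)
  have "derivable (rules L u) (Prv e x)" "derivable (rules L u) (Sentence x)"
    using \<phi> derivable_closed[of L u] by (simp_all add: prv_rules_complete wf_complete)
  then show "derivable (rules L u) (Thm e x)"
    using closed_under_nth[OF derivable_closed(3), of 11 L u] by (simp add: prv_rules_def)
qed

lemma ax_eq: "ce_set u = gn ` U \<Longrightarrow> ax u = U"
  by (simp add: ax_def)

text \<open>\<open>derivable_sound\<close> gives the forward directions. Backwards, the conditions
  in \<open>meaning\<close> become premises by completeness of \<open>Run\<close>,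
  \<open>Prv\<close> and \<open>Sentence\<close>.\<close>

lemma
  assumes u: "theory_index L u"
  shows derivable_SelfI_iff: "derivable (rules L u) (SelfI q x) \<longleftrightarrow> meaning L u (SelfI q x)"
    and derivable_SelfJ_iff: "derivable (rules L u) (SelfJ q x) \<longleftrightarrow> meaning L u (SelfJ q x)"
    and derivable_SelfK_iff: "derivable (rules L u) (SelfK q x) \<longleftrightarrow> meaning L u (SelfK q x)"
proof -
  let ?D = "derivable (rules L u)"
  note run = run_rules_complete[OF derivable_closed(1)[of L u]]
  note sentence = wf_complete(3)[OF derivable_closed(2)[of L u]]
  obtain z i j where q: "q = \<langle>z, \<langle>i, j\<rangle>\<rangle>"
    by (metis prod.collapse prod_decode_inverse)
  have I: "?D (SelfI q x)" if "meaning L u (SelfI q x)"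
  proof -
    from that q obtain y where "run (prog_of z) q = Some x" "run (prog_of i) x = Some y"
        "x \<in> gn ` sentences L"
      by (auto simp: ce_set_def)
    then have prems: "?D (Run z q x)" "?D (Run i x y)" "?D (Sentence x)"
      using run sentence by auto
    have "\<forall>z i j x y. list_all ?D [Run z \<langle>z, \<langle>i, j\<rangle>\<rangle> x, Run i x y, Sentence x] \<longrightarrow>
        ?D (SelfI \<langle>z, \<langle>i, j\<rangle>\<rangle> x)"
      using derivable_closed(4)[of L u]
      unfolding self_rules_def list.pred_inject closed_under_for_all closed_under_clause
      by (elim conjE)
    from this[rule_format, of z i j x y] show ?thesis using prems q by simp
  qed
  have J: "?D (SelfJ q x)" if "meaning L u (SelfJ q x)"
    using that unfolding meaning.simps
  proof
    assume "run (prog_of (left q)) q = Some x \<and> x \<in> ce_set (right (right q))"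
    then obtain y where "run (prog_of z) q = Some x" "run (prog_of j) x = Some y"
      using q by (auto simp: ce_set_def)
    then have prems: "?D (Run z q x)" "?D (Run j x y)"
      using run by auto
    have "\<forall>z i j x y. list_all ?D [Run z \<langle>z, \<langle>i, j\<rangle>\<rangle> x, Run j x y] \<longrightarrow>
        ?D (SelfJ \<langle>z, \<langle>i, j\<rangle>\<rangle> x)"
      using derivable_closed(4)[of L u]
      unfolding self_rules_def list.pred_inject closed_under_for_all closed_under_clause
      by (elim conjE)
    from this[rule_format, of z i j x y] show ?thesis using prems q by simp
  next
    assume "x \<in> gn ` refutable_set L (ax u)"
    then obtain \<phi> where \<phi>: "x = gn \<phi>" "\<phi> \<in> sentences L" "prv L (ax u) (Neg \<phi>)"
      by (auto simp: refutable_set_def)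
    then have "?D (Prv u (gNeg x))" "?D (Sentence x)"
      using prv_rules_complete[OF derivable_closed(1-3)[of L u] \<phi>(3)] sentence by simp_all
    then show ?thesis
      using closed_under_nth[OF derivable_closed(4), of 2 u L] by (simp add: self_rules_def)
  qed
  have K: "?D (SelfK q x)" if "meaning L u (SelfK q x)"
    using that unfolding meaning.simps
  proof
    assume "x \<in> ce_set u"
    then obtain y where "run (prog_of u) x = Some y" by (auto simp: ce_set_def)
    then have "?D (Run u x y)" by (rule run)
    then show ?thesis
      using closed_under_nth[OF derivable_closed(4), of 3 u L] by (auto simp add: self_rules_def)
  next
    assume "run (prog_of (left q)) q = Some x \<and> x \<in> ce_set (left (right q)) \<and> x \<in> gn ` sentences L"
    then have "?D (SelfI q x)" by (intro I) simp
    then show ?thesis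
      using closed_under_nth[OF derivable_closed(4), of 4 u L] by (simp add: self_rules_def)
  qed
  show "?D (SelfI q x) \<longleftrightarrow> meaning L u (SelfI q x)"
    "?D (SelfJ q x) \<longleftrightarrow> meaning L u (SelfJ q x)"
    "?D (SelfK q x) \<longleftrightarrow> meaning L u (SelfK q x)"
    using I J K derivable_sound[OF u] by blast+
qed

section \<open>Parametrised index functions\<close>

text \<open>The parameter \<open>q\<close> is built into the program as a constant, and the index of
  that program is a computable function of \<open>q\<close>.\<close>

lemma smn:
  assumes C: "ce C" and h: "total_computable h"
  obtains s where "total_computable s" "\<And>q. ce_set (s q) = {x. h \<langle>q, x\<rangle> \<in> C}"
proof -
  obtain c where c: "C = ce_set c" using C by (auto simp: ce_def)
  obtain p where p: "\<And>x. run p x = Some (h x)" by (rule total_computableE[OF h]) blast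
  obtain hi where hi: "prog_of hi = p" using surj_prog_of by blast
  obtain ii where ii: "prog_of ii = PPair PFst PSnd" using surj_prog_of by blast
  \<comment> \<open>\<open>k q\<close> is an index of the constant function \<open>q\<close>:
    starting from \<open>PZero\<close> with index 0, compose \<open>q\<close> times with
    \<open>PSucc\<close>, whose index is 1.\<close>
  define k where "k q = rec_nat 0 (\<lambda>_ v. 4 * \<langle>1, v\<rangle> + 5) q" for q :: nat
  have k: "run (prog_of (k q)) x = Some q" for q x
    by (induction q) (simp_all add: k_def prog_of_small prog_of_compound)
  \<comment> \<open>The composition of \<open>c\<close>, \<open>h\<close> and the pairing of the
    constant \<open>q\<close> with the identity \<open>PPair PFst PSnd\<close>.\<close>
  define s where "s q = 4 * \<langle>c, 4 * \<langle>hi, 4 * \<langle>k q, ii\<rangle> + 4\<rangle> + 5\<rangle> + 5" for q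
  have "total_computable s"
    unfolding s_def k_def by (intro computable_intros computable_rec)
  moreover have "ce_set (s q) = {x. h \<langle>q, x\<rangle> \<in> C}" for q
    by (simp add: s_def ce_set_def prog_of_compound k ii hi p c)
  ultimately show ?thesis using that by blast
qed

text \<open>A section of the single c.e. set of codes of derivable facts; each choice of
  \<open>F\<close> yields one of the index functions used in the theorem.\<close>

lemma derivable_index:
  assumes "computable_lang L" and "total_computable (\<lambda>w. fact_code (F (left w) (right w)))"
  obtains s where "total_computable s" "\<And>q. ce_set (s q) = {x. derivable (rules L u) (F q x)}"
proof -
  let ?C = "{x. \<exists>f. derivable (rules L u) f \<and> fact_code f = x}"
  have "ce ?C"
    by (rule ce_derivable[OF computable_rules[OF assms(1)] _ inj_fact_code])
      (simp add: rules_def run_rules_def)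
  then show ?thesis
  proof (rule smn[OF _ assms(2)])
    fix s assume "total_computable s"
      and "\<And>q. ce_set (s q) = {x. fact_code (F (left \<langle>q, x\<rangle>) (right \<langle>q, x\<rangle>)) \<in> ?C}"
    then show ?thesis using that by (simp add: inj_eq[OF inj_fact_code])
  qed
qed

section \<open>The equivalence\<close>

lemma prv_cut:
  assumes "prv L S \<phi>" "\<And>\<psi>. \<psi> \<in> S \<Longrightarrow> prv L T \<psi>"
  shows "prv L T \<phi>"
  using assms(1)
proof induction
  case (MP \<phi> \<psi>)
  show ?case using MP.IH by (rule prv.MP)
qed (simp_all add: assms(2) prv.intros(2-9) prv.Gen)

lemma prv_mono: "prv L S \<phi> \<Longrightarrow> S \<subseteq> T \<Longrightarrow> prv L T \<phi>"
  by (erule prv_cut) (auto intro: prv.Ax)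

text \<open>Since \<open>\<nu>\<close> is closed, it equals its lifting and \<open>Vac\<close> gives
  \<open>Imp \<nu> (All \<nu>)\<close>; this is what the generalization case needs.\<close>

lemma deduction:
  assumes "prv L (insert \<nu> T) \<phi>" and \<nu>: "\<nu> \<in> sentences L" and T: "T \<subseteq> sentences L"
  shows "prv L T (Imp \<nu> \<phi>)"
proof -
  have wf: "wf_fm L \<nu>" and lift: "lift_fm 0 \<nu> = \<nu>"
    using \<nu> by (auto simp: sentences_def lift_fm_eq_self_iff)
  have weaken: "prv L T (Imp \<nu> \<phi>)" if "prv L T \<phi>" for \<phi>
    by (rule prv.MP[OF prv.K[OF prv_wf[OF that T] wf] that])
  have self: "prv L T (Imp \<nu> \<nu>)"
    using prv.MP[OF prv.MP[OF prv.S[OF wf, of "Imp \<nu> \<nu>" \<nu>] prv.K] prv.K] wf by simp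
  show ?thesis using assms(1)
  proof induction
    case (Ax \<phi>)
    then show ?case using self weaken[OF prv.Ax] by blast
  next
    case (MP \<phi> \<psi>)
    have "wf_fm L (Imp \<phi> \<psi>)" using prv_wf[OF MP.hyps(1)] \<nu> T by simp
    then show ?case using prv.MP[OF prv.MP[OF prv.S MP.IH(1)] MP.IH(2)] wf by simp
  next
    case (Gen \<phi>)
    have "wf_fm L \<phi>" using prv_wf[OF Gen.hyps(1)] \<nu> T by simp
    then have imp: "prv L T (Imp (All \<nu>) (All \<phi>))"
      using prv.MP[OF prv.AllImp prv.Gen[OF Gen.IH]] wf by simp
    have vac: "prv L T (Imp \<nu> (All \<nu>))" using prv.Vac[OF wf] lift by simp
    show ?case
      using prv.MP[OF prv.MP[OF prv.S weaken[OF imp]] vac] wf \<open>wf_fm L \<phi>\<close> by simp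
  qed (simp_all add: weaken prv.intros(2-9))
qed

text \<open>A common element would be both proved and refuted by the extension
  \<open>T\<close>.\<close>

lemma provable_refutable_disjoint:
  assumes "consistent L T" "is_theory L T" "subtheory L S T" "subtheory L U T"
  shows "provable_set L S \<inter> refutable_set L U = {}"
proof -
  have False if "prv L S \<phi>" "prv L U (Neg \<phi>)" for \<phi>
  proof -
    have "prv L T \<phi>" using that(1)
      by (rule prv_cut) (use assms(3) in \<open>auto simp: subtheory_def provable_set_def\<close>)
    moreover have "prv L T (Neg \<phi>)" using that(2)
      by (rule prv_cut) (use assms(4) in \<open>auto simp: subtheory_def provable_set_def\<close>)
    ultimately show False using assms(1) prv.MP unfolding consistent_def by blast
  qed
  then show ?thesis by (auto simp: provable_set_def refutable_set_def)
qed

lemma subtheory_subset: "S \<subseteq> T \<Longrightarrow> is_theory L T \<Longrightarrow> subtheory L S T"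
  by (auto simp: subtheory_def is_theory_def provable_set_def intro: prv.Ax)

text \<open>The fixed point argument, with \<open>r\<close> the value \<open>\<Phi> a b c\<close> of the creative function. If it
  violated the conclusion, then the three sets would be admissible arguments of the creative
  function and its value would lie in one of the sets that it has to avoid.\<close>

lemma generative_value:
  assumes U: "is_theory L U" "consistent L U" and X: "X \<subseteq> sentences L"
    and a: "ce_set a = {x. r = Some x \<and> x \<in> I \<and> x \<in> gn ` sentences L}"
    and b: "ce_set b = {x. r = Some x \<and> x \<in> J \<or> x \<in> gn ` refutable_set L U}"
    and c: "ce_set c = gn ` U \<union> ce_set a"
    and creative: "theory_index L c \<Longrightarrow> consistent L (ax c) \<Longrightarrow> subtheory L U (ax c) \<Longrightarrow>
      theory_index L a \<Longrightarrow> subtheory L (ax a) (ax c) \<Longrightarrow>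
      gn ` provable_set L (ax a) \<inter> ce_set b = {} \<Longrightarrow>
      \<exists>n. r = Some n \<and> n \<in> gn ` X \<and> n \<notin> gn ` provable_set L (ax a) \<union> ce_set b"
  obtains n where "r = Some n"
    and "I \<inter> J = {} \<Longrightarrow> n \<in> gn ` provable_set L {} \<longleftrightarrow> n \<in> J"
    and "I \<inter> J = {} \<Longrightarrow> n \<in> gn ` refutable_set L U \<longleftrightarrow> n \<in> I"
    and "n \<notin> I \<union> J \<Longrightarrow> n \<in> gn ` X"
proof -
  let ?P = "gn ` provable_set L {}" and ?R = "gn ` refutable_set L U"
  \<comment> \<open>Pure logic and \<open>U\<close> are both subtheories of the consistent theory
    \<open>U\<close>.\<close>
  have disj: "?P \<inter> ?R = {}"
    using provable_refutable_disjoint[OF U(2,1), of "{}" U] subtheory_subset[OF _ U(1)]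
    by (auto simp: inj_eq[OF inj_gn])
  \<comment> \<open>With \<open>ce_set a\<close> empty, the creative function is applied to pure
    logic, to \<open>ce_set b\<close> and to the extension \<open>U\<close> of itself.\<close>
  have base: "\<exists>n. r = Some n \<and> n \<in> gn ` X \<and> n \<notin> ?P \<union> ce_set b"
    if "ce_set a = {}" "?P \<inter> ce_set b = {}"
  proof -
    have ax: "ax a = {}" "ax c = U" using that(1) c by (auto simp: ax_def)
    show ?thesis
      using creative U that c unfolding ax
      by (auto simp: theory_index_def is_theory_def subtheory_subset)
  qed
  \<comment> \<open>If \<open>r\<close> diverged, \<open>ce_set a\<close> would be empty and
    \<open>ce_set b\<close> would be \<open>?R\<close>; then \<open>base\<close> applies and yields
    a value after all.\<close>
  obtain n where n: "r = Some n"
    using base disj a b by (cases r) auto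
  have avoid: "n \<in> gn ` X" "n \<notin> ?P" "n \<notin> ?R" if "n \<notin> I \<union> J"
  proof -
    have "ce_set a = {}" "ce_set b = ?R" using a b n that by auto
    then show "n \<in> gn ` X" "n \<notin> ?P" "n \<notin> ?R" using base disj n by auto
  qed
  \<comment> \<open>Here \<open>n\<close> itself belongs to \<open>ce_set b\<close>; were it not
    valid, \<open>base\<close> would apply and make the value \<open>n\<close> avoid that
    set.\<close>
  have J: "n \<in> ?P" if "n \<in> J" "n \<notin> I"
  proof (rule ccontr)
    assume "n \<notin> ?P"
    moreover have "ce_set a = {}" "ce_set b = insert n ?R" using a b n that by auto
    ultimately show False using base disj n by auto
  qed
  have I: "n \<in> ?R" if "n \<in> I" "n \<notin> J"
  proof (rule ccontr)
    assume notR: "n \<notin> ?R"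
    have bR: "ce_set b = ?R" using b n that by auto
    show False
    \<comment> \<open>If \<open>n\<close> is no sentence, \<open>ce_set a\<close> is empty and
      \<open>base\<close> puts \<open>n\<close> into \<open>X\<close>, a set of sentences.\<close>
    proof (cases "n \<in> gn ` sentences L")
      case False
      then have "ce_set a = {}" using a n by auto
      then have "n \<in> gn ` X" using base disj bR n by auto
      then show False using False X by auto
    next
      case True
      then obtain \<nu> where \<nu>: "n = gn \<nu>" "\<nu> \<in> sentences L" by blast
      have a': "ce_set a = gn ` {\<nu>}" using a n that True \<nu> by auto
      then have c': "ce_set c = gn ` insert \<nu> U" using c by auto
      have ax: "ax a = {\<nu>}" "ax c = insert \<nu> U" unfolding ax_def a' c' by auto
      have th: "is_theory L (insert \<nu> U)" using U(1) \<nu>(2) by (simp add: is_theory_def)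
      \<comment> \<open>By the deduction theorem an inconsistency would make \<open>U\<close> refute
        \<open>\<nu>\<close>, against \<open>notR\<close>.\<close>
      have cons: "consistent L (insert \<nu> U)"
        using deduction[of L \<nu> U Fls] U(1) \<nu> notR
        by (auto simp: consistent_def is_theory_def refutable_set_def)
      have sub: "subtheory L {\<nu>} (insert \<nu> U)" "subtheory L U (insert \<nu> U)"
        using th by (auto intro: subtheory_subset)
      have "provable_set L {\<nu>} \<inter> refutable_set L U = {}"
        by (rule provable_refutable_disjoint[OF cons th sub])
      then have "gn ` provable_set L {\<nu>} \<inter> ce_set b = {}"
        unfolding bR by auto
      moreover have "theory_index L c" "theory_index L a"
        using th \<nu>(2) by (auto simp: theory_index_def c' a' is_theory_def)
      \<comment> \<open>The value must avoid the theorems of \<open>{\<nu>}\<close>, yet it codes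
        the axiom \<open>\<nu>\<close>.\<close>
      ultimately have "n \<notin> gn ` provable_set L {\<nu>}"
        using creative cons sub n unfolding ax by auto
      then show False using \<nu> by (auto simp: provable_set_def intro: prv.Ax)
    qed
  qed
  \<comment> \<open>For the converse directions, \<open>disj\<close> excludes membership in the
    other set and \<open>avoid\<close> excludes membership in neither.\<close>
  show thesis
    using n avoid I J disj by (intro that) blast+
qed

lemma fact_code_computable:
  "total_computable (\<lambda>w. fact_code (Thm (left w) (right w)))"
  "total_computable (\<lambda>w. fact_code (SelfI (left w) (right w)))"
  "total_computable (\<lambda>w. fact_code (SelfJ (left w) (right w)))"
  "total_computable (\<lambda>w. fact_code (SelfK (left w) (right w)))"
  by (simp_all only: fact_code.simps tuple.simps) (intro computable_intros)+

theorem theorem5p4: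
  fixes L :: lang and U X :: "fm set"
  assumes "computable_lang L"
    and "is_theory L U"
    and "ce (gn ` U)"
    and "consistent L U"
    and "X \<subseteq> sentences L"
  shows "strongly_doubly_generative L U X \<longleftrightarrow>
         effectively_essentially_hereditarily_creative L U X"
proof
  obtain u where u: "ce_set u = gn ` U" using assms(3) by (auto simp: ce_def)
  have ti: "theory_index L u" and ax: "ax u = U"
    using assms(2) by (auto simp: theory_index_def u is_theory_def ax_eq)
  {
    assume "strongly_doubly_generative L U X"
    then obtain \<Phi> where \<Phi>: "total_computable2 \<Phi>"
      and gen: "\<And>i j. ce_set i \<inter> ce_set j = {} \<Longrightarrow>
          (\<Phi> i j \<in> gn ` provable_set L {} \<longleftrightarrow> \<Phi> i j \<in> ce_set j) \<and>
          (\<Phi> i j \<in> gn ` refutable_set L U \<longleftrightarrow> \<Phi> i j \<in> ce_set i) \<and>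
          (\<Phi> i j \<notin> ce_set i \<union> ce_set j \<longrightarrow> \<Phi> i j \<in> gn ` X)"
      unfolding strongly_doubly_generative_def by blast
    \<comment> \<open>Whenever \<open>i\<close> indexes a theory, the set with index
      \<open>g i\<close> consists of its theorems.\<close>
    obtain g where g: "total_computable g"
      and g_set: "\<And>i. ce_set (g i) = {x. derivable (rules L u) (Thm i x)}"
      by (rule derivable_index[OF assms(1) fact_code_computable(1)]) blast
    have "total_computable (\<lambda>x. \<Phi> (g (left x)) (left (right x)))"
      using computable_compose[OF \<Phi>[unfolded total_computable2_def],
          of "\<lambda>x. \<langle>g (left x), left (right x)\<rangle>"]
      by (simp add: computable_intros computable_compose[OF g])
    then have "partial_computable3 (\<lambda>i j k. Some (\<Phi> (g i) j))"
      by (simp add: partial_computable3_def total_computable_def)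
    moreover have avoid: "\<Phi> (g i) j \<in> gn ` X \<and> \<Phi> (g i) j \<notin> gn ` provable_set L (ax i) \<union> ce_set j"
      if k: "theory_index L k" "consistent L (ax k)" "subtheory L U (ax k)"
        and i: "theory_index L i" "subtheory L (ax i) (ax k)"
        and j: "gn ` provable_set L (ax i) \<inter> ce_set j = {}" for i j k
    proof -
      have gi: "ce_set (g i) = gn ` provable_set L (ax i)"
        by (simp add: g_set derivable_Thm_iff[OF ti i(1)])
      have "provable_set L (ax i) \<inter> refutable_set L U = {}"
        using i(2) k by (intro provable_refutable_disjoint) (auto simp: subtheory_def)
      then have "gn ` provable_set L (ax i) \<inter> gn ` refutable_set L U = {}"
        by auto
      moreover have "gn ` provable_set L {} \<subseteq> gn ` provable_set L (ax i)"
        by (auto simp: provable_set_def intro: prv_mono)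
      moreover note gen = gen[of "g i" j, unfolded gi, OF j]
      ultimately have "\<Phi> (g i) j \<notin> gn ` provable_set L (ax i)" "\<Phi> (g i) j \<notin> ce_set j"
        using j by (meson disjoint_iff subsetD)+
      then show ?thesis using gen by simp
    qed
    ultimately show "effectively_essentially_hereditarily_creative L U X"
      unfolding effectively_essentially_hereditarily_creative_def
      by (intro exI[of _ "\<lambda>i j k. Some (\<Phi> (g i) j)"] conjI allI impI)
        (assumption, elim conjE, frule (5) avoid, simp)
  }
  {
    assume "effectively_essentially_hereditarily_creative L U X"
    then obtain \<Phi> where \<Phi>: "partial_computable3 \<Phi>"
      and creative: "\<And>i j k. theory_index L k \<Longrightarrow> consistent L (ax k) \<Longrightarrow> subtheory L U (ax k) \<Longrightarrow>
          theory_index L i \<Longrightarrow> subtheory L (ax i) (ax k) \<Longrightarrow>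
          gn ` provable_set L (ax i) \<inter> ce_set j = {} \<Longrightarrow>
          \<exists>n. \<Phi> i j k = Some n \<and> n \<in> gn ` X \<and> n \<notin> gn ` provable_set L (ax i) \<union> ce_set j"
      unfolding effectively_essentially_hereditarily_creative_def by blast
    obtain p where p: "\<And>x. run p x = \<Phi> (left x) (left (right x)) (right (right x))"
      using \<Phi> unfolding partial_computable3_def partial_computable_def by blast
    obtain \<alpha> where \<alpha>: "total_computable \<alpha>"
      "\<And>q. ce_set (\<alpha> q) = {x. derivable (rules L u) (SelfI q x)}"
      by (rule derivable_index[OF assms(1) fact_code_computable(2)]) blast
    obtain \<beta> where \<beta>: "total_computable \<beta>"
      "\<And>q. ce_set (\<beta> q) = {x. derivable (rules L u) (SelfJ q x)}"
      by (rule derivable_index[OF assms(1) fact_code_computable(3)]) blast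
    obtain \<gamma> where \<gamma>: "total_computable \<gamma>"
      "\<And>q. ce_set (\<gamma> q) = {x. derivable (rules L u) (SelfK q x)}"
      by (rule derivable_index[OF assms(1) fact_code_computable(4)]) blast
    have "total_computable (\<lambda>q. \<langle>\<alpha> q, \<langle>\<beta> q, \<gamma> q\<rangle>\<rangle>)"
      by (intro computable_intros \<alpha>(1) \<beta>(1) \<gamma>(1))
    then obtain p' where p': "\<And>q. run p' q = Some \<langle>\<alpha> q, \<langle>\<beta> q, \<gamma> q\<rangle>\<rangle>"
      by (rule total_computableE) blast
    \<comment> \<open>\<open>d\<close> sends \<open>q\<close> to the value of \<open>\<Phi>\<close>
      at the three indices computed from \<open>q\<close>. Running it on an input that begins with
      \<open>d\<close> replaces an appeal to the recursion theorem.\<close>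
    obtain d where d: "prog_of d = PComp p p'" using surj_prog_of by blast
    define r where "r i j = run (prog_of d) \<langle>d, \<langle>i, j\<rangle>\<rangle>" for i j
    \<comment> \<open>Convergence is claimed for all \<open>i\<close> and \<open>j\<close>, since
      the generative function must be total; the other claims are made for disjoint sets.\<close>
    have r_value: "\<exists>n. r i j = Some n \<and> (ce_set i \<inter> ce_set j = {} \<longrightarrow>
          (n \<in> gn ` provable_set L {} \<longleftrightarrow> n \<in> ce_set j) \<and>
          (n \<in> gn ` refutable_set L U \<longleftrightarrow> n \<in> ce_set i) \<and>
          (n \<notin> ce_set i \<union> ce_set j \<longrightarrow> n \<in> gn ` X))" for i j
    proof -
      let ?q = "\<langle>d, \<langle>i, j\<rangle>\<rangle>"
      \<comment> \<open>Since \<open>left ?q\<close> is \<open>d\<close>, the three sets below are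
        defined from the very value that \<open>\<Phi>\<close> takes at their indices.\<close>
      have r: "r i j = \<Phi> (\<alpha> ?q) (\<beta> ?q) (\<gamma> ?q)" by (simp add: r_def d p p')
      have a: "ce_set (\<alpha> ?q) = {x. r i j = Some x \<and> x \<in> ce_set i \<and> x \<in> gn ` sentences L}"
        by (simp add: \<alpha>(2) derivable_SelfI_iff[OF ti] r_def)
      have b: "ce_set (\<beta> ?q) = {x. r i j = Some x \<and> x \<in> ce_set j \<or> x \<in> gn ` refutable_set L U}"
        by (simp add: \<beta>(2) derivable_SelfJ_iff[OF ti] r_def ax)
      have c: "ce_set (\<gamma> ?q) = gn ` U \<union> ce_set (\<alpha> ?q)"
        unfolding a by (auto simp: \<gamma>(2) derivable_SelfK_iff[OF ti] r_def u)
      note creative' = creative[where i = "\<alpha> ?q" and j = "\<beta> ?q" and k = "\<gamma> ?q", folded r]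
      show ?thesis
        by (rule generative_value[OF assms(2,4,5) a b c creative'], assumption+) blast
    qed
    obtain p'' where p'': "\<And>x. run p'' x = Some \<langle>d, \<langle>left x, right x\<rangle>\<rangle>"
      by (rule total_computableE[of "\<lambda>x. \<langle>d, \<langle>left x, right x\<rangle>\<rangle>"])
        (intro computable_intros, blast)
    have "run (PComp (prog_of d) p'') x = Some (the (r (left x) (right x)))" for x
      using r_value[of "left x" "right x"] by (auto simp: p'' r_def)
    then have "total_computable2 (\<lambda>i j. the (r i j))"
      unfolding total_computable2_def by (rule total_computableI)
    moreover have "(the (r i j) \<in> gn ` provable_set L {} \<longleftrightarrow> the (r i j) \<in> ce_set j) \<and>
          (the (r i j) \<in> gn ` refutable_set L U \<longleftrightarrow> the (r i j) \<in> ce_set i) \<and>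
          (the (r i j) \<notin> ce_set i \<union> ce_set j \<longrightarrow> the (r i j) \<in> gn ` X)"
      if "ce_set i \<inter> ce_set j = {}" for i j
      using r_value[of i j] that by auto
    ultimately show "strongly_doubly_generative L U X"
      unfolding strongly_doubly_generative_def
      by (intro exI[of _ "\<lambda>i j. the (r i j)"] conjI allI impI) simp_all
  }
qed

end
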